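(* Let $1\le j\le 6$ and let $G_1, G_2, H_1$ and $H_2$ be finite groups such that $G_i\sim_j H_i$ for $i=1, 2$. Then $G_1\times G_2\sim_j H_1\times H_2$.
   Context: For a finite group $G$, $\mathrm{ord}(g)$ is the order of $g\in G$. - $\mathcal O(G)$ is the multiset $\{\mathrm{ord}(g): g\in G\}$ of orders of elements of $G$ (counted with multiplicity). - $\mathcal C_G$ is the set of all cyclic subgroups of $G$. $\Lambda(G)$ is the vertex-weighted digraph with vertex set $\mathcal C_G$, each vertex $C$ weighted by its order $\# C$, with a directed edge $C_1\to C_2$ whenever $C_2\subsetneq C_1$. - The power graph $\Gamma(G)$ is the undirected graph with vertex set $G$ in which $g,h$ are connected if $g\neq h$ and $g=h^k$ or $h=g^k$ for some integer $k$. - For $t\in\mathbb Z$, $\Gamma_t(G)$ is the directed graph with vertex set $G$ and edge set $\{g\to g^t: g\in G\}$ (loops allowed). Equivalence relations on finite groups $G,H$: (1) $G\sim_1 H$ if $G\cong H$ as groups; (2) $G\sim_2 H$ if there is a bijection $\varphi:G\to H$ with $\varphi(g^t)=\varphi(g)^t$ for all $g\in G$, $t\in\mathbb Z$; (3) $G\sim_3 H$ if $\Lambda(G)\cong\Lambda(H)$ as vertex-weighted digraphs; (4) $G\sim_4 H$ if $\Gamma(G)\cong\Gamma(H)$; (5) $G\sim_5 H$ if $\Gamma_t(G)\cong\Gamma_t(H)$ for every $t\in\mathbb Z$; (6) $G\sim_6 H$ if $\mathcal O(G)=\mathcal O(H)$. *)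

theory Defs
  imports
    "HOL-Algebra.Multiplicative_Group"
    "HOL-Algebra.Elementary_Groups"
    "HOL-Library.Multiset"
    "Graph_Theory.Pair_Digraph"
    "Graph_Theory.Digraph_Isomorphism"
begin

definition order_multiset :: "('a, 'm) monoid_scheme \<Rightarrow> nat multiset" where
  "order_multiset G = image_mset (group.ord G) (mset_set (carrier G))"

definition cyclic_subgroups :: "('a, 'm) monoid_scheme \<Rightarrow> 'a set set" where
  "cyclic_subgroups G = {C. subgroup C G \<and> cyclic_group (G\<lparr>carrier := C\<rparr>)}"

definition cyclic_subgroup_digraph :: "('a, 'm) monoid_scheme \<Rightarrow> 'a set pair_pre_digraph" where
  "cyclic_subgroup_digraph G =
     \<lparr>pverts = cyclic_subgroups G,
      parcs = {(C1, C2). C1 \<in> cyclic_subgroups G \<and> C2 \<in> cyclic_subgroups G \<and> C2 \<subset> C1}\<rparr>"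

text \<open>An undirected graph is modelled, as in \<^theory>\<open>Graph_Theory.Digraph\<close>, by a symmetric digraph.\<close>

definition power_graph :: "('a, 'm) monoid_scheme \<Rightarrow> 'a pair_pre_digraph" where
  "power_graph G =
     \<lparr>pverts = carrier G,
      parcs = {(g, h). g \<in> carrier G \<and> h \<in> carrier G \<and> g \<noteq> h \<and>
                 (\<exists>k::int. g = h [^]\<^bsub>G\<^esub> k \<or> h = g [^]\<^bsub>G\<^esub> k)}\<rparr>"

definition power_map_digraph :: "int \<Rightarrow> ('a, 'm) monoid_scheme \<Rightarrow> 'a pair_pre_digraph" where
  "power_map_digraph t G =
     \<lparr>pverts = carrier G, parcs = {(g, g [^]\<^bsub>G\<^esub> t) | g. g \<in> carrier G}\<rparr>"

definition pair_digraph_iso :: "'a pair_pre_digraph \<Rightarrow> 'b pair_pre_digraph \<Rightarrow> bool" where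
  "pair_digraph_iso X Y \<longleftrightarrow> digraph_iso (with_proj X) (with_proj Y)"

definition weighted_digraph_iso ::
  "'a pair_pre_digraph \<Rightarrow> ('a \<Rightarrow> nat) \<Rightarrow> 'b pair_pre_digraph \<Rightarrow> ('b \<Rightarrow> nat) \<Rightarrow> bool" where
  "weighted_digraph_iso X v Y w \<longleftrightarrow>
     (\<exists>f. pre_digraph.digraph_isomorphism (with_proj X) f \<and>
          with_proj Y = app_iso f (with_proj X) \<and>
          (\<forall>x \<in> pverts X. w (iso_verts f x) = v x))"

text \<open>The library's isomorphisms carry separate maps on vertices and on arcs. For digraphs whose
  arcs are pairs of vertices the arc map is forced, which gives the usual notion.\<close>

lemma weighted_digraph_iso_iff:
  assumes "pair_wf_digraph X" "pair_wf_digraph Y"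
  shows "weighted_digraph_iso X v Y w \<longleftrightarrow>
    (\<exists>\<phi>. bij_betw \<phi> (pverts X) (pverts Y) \<and>
         (\<forall>x\<in>pverts X. \<forall>y\<in>pverts X. (x, y) \<in> parcs X \<longleftrightarrow> (\<phi> x, \<phi> y) \<in> parcs Y) \<and>
         (\<forall>x\<in>pverts X. w (\<phi> x) = v x))"
proof
  interpret X: pair_wf_digraph X by fact
  assume "weighted_digraph_iso X v Y w"
  then obtain f where f: "pre_digraph.digraph_isomorphism (with_proj X) f"
    "with_proj Y = app_iso f (with_proj X)" "\<forall>x\<in>pverts X. w (iso_verts f x) = v x"
    unfolding weighted_digraph_iso_def by blast
  let ?p = "iso_verts f"
  have inj: "inj_on ?p (pverts X)"
    using f(1) by (simp add: pre_digraph.digraph_isomorphism_def)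
  have V: "pverts Y = ?p ` pverts X" and A: "parcs Y = iso_arcs f ` parcs X"
    and T: "iso_tail f = fst" and H: "iso_head f = snd"
    using arg_cong[OF f(2), of verts] arg_cong[OF f(2), of arcs]
      arg_cong[OF f(2), of tail] arg_cong[OF f(2), of head] by simp_all
  have "iso_arcs f (x, y) = (?p x, ?p y)" if "(x, y) \<in> parcs X" for x y
    using f(1) that T H by (force simp: pre_digraph.digraph_isomorphism_def prod_eq_iff)
  then have A': "parcs Y = (\<lambda>(x, y). (?p x, ?p y)) ` parcs X"
    unfolding A by (intro image_cong) auto
  have "(x, y) \<in> parcs X" if "x \<in> pverts X" "y \<in> pverts X" "(?p x, ?p y) \<in> parcs Y" for x y
  proof -
    from that(3) obtain a b where ab: "(a, b) \<in> parcs X" "?p x = ?p a" "?p y = ?p b"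
      unfolding A' by auto
    moreover have "a \<in> pverts X" "b \<in> pverts X"
      using X.arc_fst_in_verts[OF ab(1)] X.arc_snd_in_verts[OF ab(1)] by auto
    ultimately show ?thesis using inj that by (metis inj_onD)
  qed
  then have "(x, y) \<in> parcs X \<longleftrightarrow> (?p x, ?p y) \<in> parcs Y"
    if "x \<in> pverts X" "y \<in> pverts X" for x y
    using that A' by (metis (mono_tags, lifting) case_prod_conv image_eqI)
  then show "\<exists>\<phi>. bij_betw \<phi> (pverts X) (pverts Y) \<and>
         (\<forall>x\<in>pverts X. \<forall>y\<in>pverts X. (x, y) \<in> parcs X \<longleftrightarrow> (\<phi> x, \<phi> y) \<in> parcs Y) \<and>
         (\<forall>x\<in>pverts X. w (\<phi> x) = v x)"
    using inj V f(3) by (intro exI[of _ ?p]) (auto simp: bij_betw_def)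
next
  interpret X: pair_wf_digraph X by fact
  interpret Y: pair_wf_digraph Y by fact
  assume "\<exists>\<phi>. bij_betw \<phi> (pverts X) (pverts Y) \<and>
         (\<forall>x\<in>pverts X. \<forall>y\<in>pverts X. (x, y) \<in> parcs X \<longleftrightarrow> (\<phi> x, \<phi> y) \<in> parcs Y) \<and>
         (\<forall>x\<in>pverts X. w (\<phi> x) = v x)"
  then obtain p where p: "bij_betw p (pverts X) (pverts Y)"
    "\<And>x y. x \<in> pverts X \<Longrightarrow> y \<in> pverts X \<Longrightarrow> (x, y) \<in> parcs X \<longleftrightarrow> (p x, p y) \<in> parcs Y"
    "\<forall>x\<in>pverts X. w (p x) = v x" by blast
  let ?q = "\<lambda>(x, y). (p x, p y)"
  let ?f = "\<lparr>iso_verts = p, iso_arcs = ?q, iso_head = snd, iso_tail = fst\<rparr>"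
  have VX: "x \<in> pverts X \<and> y \<in> pverts X" if "(x, y) \<in> parcs X" for x y
    using X.arc_fst_in_verts[OF that] X.arc_snd_in_verts[OF that] by simp
  have VY: "x \<in> pverts Y \<and> y \<in> pverts Y" if "(x, y) \<in> parcs Y" for x y
    using Y.arc_fst_in_verts[OF that] Y.arc_snd_in_verts[OF that] by simp
  have inj: "inj_on p (pverts X)" and V: "pverts Y = p ` pverts X"
    using p(1) by (auto simp: bij_betw_def)
  have A: "parcs Y = ?q ` parcs X"
  proof (intro subset_antisym subrelI)
    fix a b assume ab: "(a, b) \<in> parcs Y"
    then obtain x y where "x \<in> pverts X" "y \<in> pverts X" "a = p x" "b = p y"
      using VY[OF ab] V by blast
    with ab p(2) show "(a, b) \<in> ?q ` parcs X" by force
  qed (use p(2) VX in auto)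
  have "inj_on ?q (parcs X)"
    using inj VX by (auto intro!: inj_onI dest: inj_onD)
  then have "pre_digraph.digraph_isomorphism (with_proj X) ?f"
    using inj by (auto simp: pre_digraph.digraph_isomorphism_def X.wf_digraph)
  moreover have "with_proj Y = app_iso ?f (with_proj X)"
    using V A by (simp add: app_iso_def with_proj_def)
  ultimately show "weighted_digraph_iso X v Y w"
    unfolding weighted_digraph_iso_def using p(3) by (intro exI[of _ ?f]) simp
qed

lemma pair_digraph_iso_iff:
  assumes "pair_wf_digraph X" "pair_wf_digraph Y"
  shows "pair_digraph_iso X Y \<longleftrightarrow>
    (\<exists>\<phi>. bij_betw \<phi> (pverts X) (pverts Y) \<and>
         (\<forall>x\<in>pverts X. \<forall>y\<in>pverts X. (x, y) \<in> parcs X \<longleftrightarrow> (\<phi> x, \<phi> y) \<in> parcs Y))"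
proof -
  have "pair_digraph_iso X Y \<longleftrightarrow> weighted_digraph_iso X (\<lambda>_. 0) Y (\<lambda>_. 0)"
    by (simp add: pair_digraph_iso_def weighted_digraph_iso_def digraph_iso_def)
  then show ?thesis using weighted_digraph_iso_iff[OF assms] by simp
qed

lemma pair_wf_cyclic_subgroup_digraph: "pair_wf_digraph (cyclic_subgroup_digraph G)"
  by unfold_locales (auto simp: cyclic_subgroup_digraph_def)

lemma pair_wf_power_graph: "pair_wf_digraph (power_graph G)"
  by unfold_locales (auto simp: power_graph_def)

lemma sym_power_graph: "sym (parcs (power_graph G))"
  by (auto simp: power_graph_def sym_def)

lemma pair_wf_power_map_digraph:
  assumes "group G" shows "pair_wf_digraph (power_map_digraph t G)"
  using group.int_pow_closed[OF assms] by unfold_locales (auto simp: power_map_digraph_def)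

definition sim1 :: "('a, 'm) monoid_scheme \<Rightarrow> ('b, 'n) monoid_scheme \<Rightarrow> bool" where
  "sim1 G H \<longleftrightarrow> G \<cong> H"

definition sim2 :: "('a, 'm) monoid_scheme \<Rightarrow> ('b, 'n) monoid_scheme \<Rightarrow> bool" where
  "sim2 G H \<longleftrightarrow>
     (\<exists>\<phi>. bij_betw \<phi> (carrier G) (carrier H) \<and>
          (\<forall>g\<in>carrier G. \<forall>t::int. \<phi> (g [^]\<^bsub>G\<^esub> t) = \<phi> g [^]\<^bsub>H\<^esub> t))"

definition sim3 :: "('a, 'm) monoid_scheme \<Rightarrow> ('b, 'n) monoid_scheme \<Rightarrow> bool" where
  "sim3 G H \<longleftrightarrow>
     weighted_digraph_iso (cyclic_subgroup_digraph G) card (cyclic_subgroup_digraph H) card"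

definition sim4 :: "('a, 'm) monoid_scheme \<Rightarrow> ('b, 'n) monoid_scheme \<Rightarrow> bool" where
  "sim4 G H \<longleftrightarrow> pair_digraph_iso (power_graph G) (power_graph H)"

definition sim5 :: "('a, 'm) monoid_scheme \<Rightarrow> ('b, 'n) monoid_scheme \<Rightarrow> bool" where
  "sim5 G H \<longleftrightarrow>
     (\<forall>t::int. pair_digraph_iso (power_map_digraph t G) (power_map_digraph t H))"

definition sim6 :: "('a, 'm) monoid_scheme \<Rightarrow> ('b, 'n) monoid_scheme \<Rightarrow> bool" where
  "sim6 G H \<longleftrightarrow> order_multiset G = order_multiset H"

definition sim :: "nat \<Rightarrow> ('a, 'm) monoid_scheme \<Rightarrow> ('b, 'n) monoid_scheme \<Rightarrow> bool" where
  "sim j G H \<longleftrightarrow>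
     j = 1 \<and> sim1 G H \<or> j = 2 \<and> sim2 G H \<or> j = 3 \<and> sim3 G H \<or>
     j = 4 \<and> sim4 G H \<or> j = 5 \<and> sim5 G H \<or> j = 6 \<and> sim6 G H"

end

theory Submission
  imports Defs "HOL-Number_Theory.Totient" "HOL-Number_Theory.Prime_Powers" "HOL-Algebra.Sylow"
begin

text \<open>
  Relations 1, 2, 5 and 6 pass to direct products by direct constructions. An isomorphism, a
  power-preserving bijection, or an isomorphism of the digraphs of the $t$-th power map is given by
  a map on each factor, and the product of the two maps serves for the product group. The order of
  $(g,h)$ is the least common multiple of the orders of $g$ and $h$, so the orders in the product,
  with multiplicities, are determined by those in the factors.

  Relations 3 and 4 speak of cyclic subgroups of $G_1 \times G_2$, and these are not determined in
  an evident way by the cyclic subgroups of the factors: whether $(x,y)$ lies in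
  $\langle (g,h) \rangle$ asks for one exponent that works in both coordinates. The theorem holds
  because both relations are equivalent to relation 2.

  To pass from subgroups to elements, generators have to be chosen compatibly. This is achieved by a
  complex-valued function $\chi$ on $G$ with $\chi(x^t) = \chi(x)^t$ whose only preimage of $1$ is
  the identity (\<open>ex_power_character\<close>). On a cyclic subgroup of order $d$ such a $\chi$ is a
  bijection onto the $d$-th roots of unity, hence an element of a cyclic subgroup is named by a root
  of unity, in the same way in all the cyclic subgroups that contain it. Suppose now that families
  $(A_i)$ and $(B_i)$ of cyclic subgroups cover $G$ and $H$ and that $A_i \cap A_j$ always has as
  many elements as $B_i \cap B_j$. Sending $g \in A_i$ to the element of $B_i$ with the same name
  is a well-defined power-preserving bijection (\<open>sim2_if_matching_families\<close>). For relation 3 the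
  families are all the cyclic subgroups of $G$ and their partners in $H$.

  For relation 4 the families have to be read off from the power graph (Cameron's theorem that the
  power graph determines the directed power graph). Call two elements twins if they have the same
  closed neighbourhood. If $y \in \langle x \rangle$ is a twin of $x \neq 1$ with $y \neq 1$ of
  smaller order, then $x$ has prime power order. If the identity is the only vertex adjacent to
  all others, then between elements that are not twins the direction of an edge can be recovered from
  the number of twins of its ends, with one ambiguity $\mathrm{ord}(x) = 2\,\mathrm{ord}(y)$ with
  $\mathrm{ord}(y)$ odd, which an involution below $x$ resolves (\<open>card_twins_mono\<close>,
  \<open>preserves_direction\<close>). It follows that the sets consisting of the twins of $x$ and
  the elements of $\langle x \rangle$, which are cyclic subgroups, are matched by every
  isomorphism of power graphs. If there are further dominating vertices, then either all elements
  of both groups have prime power order, and the sets of all $y$ whose neighbourhood contains that of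
  $x$ serve instead, or both groups are cyclic.
\<close>

section \<open>Cyclic subgroups of a finite group\<close>

locale finite_group = group G for G (structure) +
  assumes fin: "finite (carrier G)"
begin

lemma cyc_eq: "x \<in> carrier G \<Longrightarrow> generate G {x} = range (\<lambda>k::nat. x [^] k)"
  using generate_pow_on_finite_carrier[OF fin] by auto

lemma cyc_subset_carrier: "x \<in> carrier G \<Longrightarrow> generate G {x} \<subseteq> carrier G"
  by (simp add: generate_incl)

lemma cyc_carrier: "x \<in> carrier G \<Longrightarrow> y \<in> generate G {x} \<Longrightarrow> y \<in> carrier G"
  using cyc_subset_carrier by blast

lemma cyc_self: "x \<in> generate G {x}"
  by (simp add: generate.incl)

lemma card_cyc: "x \<in> carrier G \<Longrightarrow> card (generate G {x}) = ord x"
  by (simp add: generate_pow_card)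

lemma finite_cyc: "x \<in> carrier G \<Longrightarrow> finite (generate G {x})"
  using cyc_subset_carrier fin finite_subset by blast

lemma ord_pos: "x \<in> carrier G \<Longrightarrow> 0 < ord x"
  using ord_ge_1[OF fin] by fastforce

lemma cyc_mono: "x \<in> carrier G \<Longrightarrow> y \<in> generate G {x} \<Longrightarrow> generate G {y} \<subseteq> generate G {x}"
  by (rule generate_subgroup_incl) (auto intro: generate_is_subgroup)

lemma cyc_trans:
  "x \<in> carrier G \<Longrightarrow> y \<in> generate G {x} \<Longrightarrow> z \<in> generate G {y} \<Longrightarrow> z \<in> generate G {x}"
  using cyc_mono by blast

lemma pow_in_cyc: "x \<in> carrier G \<Longrightarrow> x [^] (k::nat) \<in> generate G {x}"
  by (simp add: cyc_eq)

lemma one_in_cyc: "\<one> \<in> generate G {x}"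
  by (rule generate.one)

lemma pow_eq_iff_cong:
  assumes "x \<in> carrier G"
  shows "x [^] (m::nat) = x [^] (n::nat) \<longleftrightarrow> [m = n] (mod ord x)"
proof -
  have "x [^] m = x [^] n \<longleftrightarrow> int (ord x) dvd (int n - int m)"
    using int_pow_eq[OF assms, of "int m" "int n"] by (simp add: int_pow_int)
  then show ?thesis by (metis cong_iff_dvd_diff cong_int_iff cong_sym_eq)
qed

lemma ord_dvd_of_cyc:
  assumes "x \<in> carrier G" "y \<in> generate G {x}"
  shows "ord y dvd ord x"
proof -
  obtain k :: nat where k: "y = x [^] k" using assms cyc_eq by auto
  have "y [^] ord x = \<one>"
    using assms(1) unfolding k
    by (metis mult.commute nat_pow_one nat_pow_pow pow_ord_eq_1)
  then show ?thesis using assms cyc_carrier pow_eq_id by blast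
qed

text \<open>A cyclic group has at most one subgroup of each order, and inclusion among its subgroups is
  divisibility of orders. This turns comparability of elements below a common $x$ into arithmetic.\<close>

lemma cyc_iff_dvd:
  assumes x: "x \<in> carrier G" and y: "y \<in> generate G {x}" and z: "z \<in> generate G {x}"
  shows "y \<in> generate G {z} \<longleftrightarrow> ord y dvd ord z"
proof
  assume "y \<in> generate G {z}"
  then show "ord y dvd ord z" using ord_dvd_of_cyc cyc_carrier x z by blast
next
  assume d: "ord y dvd ord z"
  obtain a :: nat where a: "y = x [^] a" using x y cyc_eq by auto
  obtain b :: nat where b: "z = x [^] b" using x z cyc_eq by auto
  have z': "z \<in> carrier G" using x z cyc_carrier by blast
  have "y [^] ord z = \<one>" using d x y cyc_carrier pow_eq_id by blast
  then have "x [^] (a * ord z) = \<one>" using x a by (simp add: nat_pow_pow)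
  then have n: "ord x dvd a * ord z" using x pow_eq_id by blast
  have "x [^] (b * ord z) = \<one>" using z' b x by (metis nat_pow_pow pow_ord_eq_1)
  have oz: "ord z * gcd (ord x) b = ord x"
  proof (cases "b = 0")
    case True then show ?thesis using b x by simp
  next
    case False then show ?thesis using ord_pow_gen[OF x, of b] b by simp
  qed
  have "gcd (ord x) b dvd a"
    using n ord_pos[OF z'] oz
    by (metis dvd_mult_cancel_left mult.commute nat_mult_dvd_cancel_disj neq0_conv)
  then have "gcd b (ord x) dvd a" by (simp add: gcd.commute)
  then obtain s where "[b * s = a] (mod ord x)"
    using cong_solve_dvd_nat by blast
  then have "x [^] (b * s) = x [^] a"
    using x by (simp add: pow_eq_iff_cong)
  then have "z [^] s = y" using a b x by (simp add: nat_pow_pow)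
  then show "y \<in> generate G {z}" using pow_in_cyc[OF z', of s] by simp
qed

lemma ex_cyc_ord:
  assumes x: "x \<in> carrier G" and d: "d dvd ord x"
  shows "\<exists>y\<in>generate G {x}. ord y = d"
proof -
  obtain k where k: "ord x = d * k" using d by blast
  have "k \<noteq> 0" "d \<noteq> 0" using k ord_pos[OF x] by auto
  then have "ord (x [^] k) = d" using ord_pow[OF x, of k] k by simp
  then show ?thesis using pow_in_cyc[OF x] by blast
qed

lemma card_gens:
  assumes x: "x \<in> carrier G"
  shows "card {y \<in> generate G {x}. ord y = ord x} = totient (ord x)"
proof -
  have inj: "inj_on (\<lambda>k. x [^] k) {1..ord x}" by (rule ord_inj'[OF x])
  have "generate G {x} = (\<lambda>k. x [^] k) ` {1..ord x}"
  proof (rule sym, rule card_subset_eq[OF finite_cyc[OF x]])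
    show "card ((\<lambda>k. x [^] k) ` {1..ord x}) = card (generate G {x})"
      using card_image[OF inj] card_cyc[OF x] by simp
  qed (use pow_in_cyc[OF x] in auto)
  then have "{y \<in> generate G {x}. ord y = ord x} = (\<lambda>k. x [^] k) ` totatives (ord x)"
    using pow_ord_eq_ord_iff[OF fin x] by (auto simp: totatives_def coprime_commute)
  moreover have "inj_on (\<lambda>k. x [^] k) (totatives (ord x))"
    by (rule inj_on_subset[OF inj]) (auto simp: totatives_def)
  ultimately show ?thesis by (simp add: card_image totient_def)
qed

lemma cyclic_subgroups_eq: "cyclic_subgroups G = (\<lambda>x. generate G {x}) ` carrier G"
proof (intro subset_antisym subsetI)
  fix C assume "C \<in> cyclic_subgroups G"
  then have C: "subgroup C G" "cyclic_group (G\<lparr>carrier := C\<rparr>)"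
    by (auto simp: cyclic_subgroups_def)
  have gen: "\<exists>x\<in>carrier (G\<lparr>carrier := C\<rparr>).
      carrier (G\<lparr>carrier := C\<rparr>) = range (\<lambda>n::int. x [^]\<^bsub>G\<lparr>carrier := C\<rparr>\<^esub> n)"
    using C(2) unfolding group.cyclic_group[OF subgroup_imp_group[OF C(1)]] .
  have c: "carrier (G\<lparr>carrier := C\<rparr>) = C" by simp
  obtain x where x: "x \<in> C" "C = range (\<lambda>n::int. x [^]\<^bsub>G\<lparr>carrier := C\<rparr>\<^esub> n)"
    using gen[unfolded c] by (rule bexE)
  have "x \<in> carrier G" using x(1) C(1) subgroup.mem_carrier by metis
  moreover have "C = generate G {x}"
    unfolding generate_pow[OF \<open>x \<in> carrier G\<close>]
    by (subst x(2)) (auto simp: int_pow_consistent[OF C(1) x(1), symmetric])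
  ultimately show "C \<in> (\<lambda>x. generate G {x}) ` carrier G" by blast
next
  fix C assume "C \<in> (\<lambda>x. generate G {x}) ` carrier G"
  then obtain x where x: "x \<in> carrier G" "C = generate G {x}" by blast
  have sg: "subgroup C G" using x generate_is_subgroup[of "{x}"] by simp
  have "x \<in> C" using x cyc_self by simp
  have "C = range (\<lambda>n::int. x [^] n)" using x generate_pow by auto
  then have "C = range (\<lambda>n::int. x [^]\<^bsub>G\<lparr>carrier := C\<rparr>\<^esub> n)"
    unfolding int_pow_consistent[OF sg \<open>x \<in> C\<close>] .
  then have "carrier (G\<lparr>carrier := C\<rparr>) = range (\<lambda>n::int. x [^]\<^bsub>G\<lparr>carrier := C\<rparr>\<^esub> n)"
    by (rule trans[rotated]) simp
  moreover have "x \<in> carrier (G\<lparr>carrier := C\<rparr>)" using \<open>x \<in> C\<close> by simp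
  ultimately have "cyclic_group (G\<lparr>carrier := C\<rparr>)"
    unfolding group.cyclic_group[OF subgroup_imp_group[OF sg]] by (rule bexI)
  then show "C \<in> cyclic_subgroups G" using sg by (simp add: cyclic_subgroups_def)
qed

lemma cyc_in_cyclic_subgroups: "x \<in> carrier G \<Longrightarrow> generate G {x} \<in> cyclic_subgroups G"
  by (simp add: cyclic_subgroups_eq)

lemma cyclic_subgroups_subset: "C \<in> cyclic_subgroups G \<Longrightarrow> C \<subseteq> carrier G"
  using cyc_subset_carrier by (auto simp: cyclic_subgroups_eq)

lemma cyclic_subgroups_pow:
  assumes "C \<in> cyclic_subgroups G" "x \<in> C"
  shows "x [^] (t::nat) \<in> C"
proof -
  obtain g where g: "g \<in> carrier G" "C = generate G {g}"
    using assms(1) cyclic_subgroups_eq by blast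
  then show ?thesis using assms(2) cyc_trans[of g x] pow_in_cyc[of x] cyc_carrier[of g x] by blast
qed

lemma Union_cyclic_subgroups: "\<Union> (cyclic_subgroups G) = carrier G"
proof (intro subset_antisym subsetI)
  fix x assume "x \<in> carrier G"
  then show "x \<in> \<Union> (cyclic_subgroups G)"
    by (intro UnionI[OF cyc_in_cyclic_subgroups cyc_self])
next
  fix x assume "x \<in> \<Union> (cyclic_subgroups G)"
  then show "x \<in> carrier G" using cyclic_subgroups_subset by (elim UnionE) (rule subsetD)
qed

text \<open>The least positive exponent $d$ with $x^d \in K$ divides every exponent occurring in $K$, by
  division with remainder, so $x^d$ generates $K$.\<close>

lemma subgroup_of_cyclic:
  assumes x: "x \<in> carrier G" and K: "subgroup K G" "K \<subseteq> generate G {x}"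
  shows "K \<in> cyclic_subgroups G"
proof -
  define d where "d = (LEAST k::nat. 0 < k \<and> x [^] k \<in> K)"
  have "0 < ord x \<and> x [^] ord x \<in> K" using x ord_pos K subgroup.one_closed by simp
  then have d: "0 < d \<and> x [^] d \<in> K" unfolding d_def by (rule LeastI)
  have least: "\<not> (0 < k \<and> x [^] k \<in> K)" if "k < d" for k
    using not_less_Least that unfolding d_def by blast
  have gen: "generate G {x [^] d} \<subseteq> K"
    using d K(1) by (intro generate_subgroup_incl) auto
  have "K \<subseteq> generate G {x [^] d}"
  proof
    fix z assume z: "z \<in> K"
    then obtain m :: nat where m: "z = x [^] m" using K x cyc_eq by auto
    have e: "x [^] (d * (m div d)) \<in> generate G {x [^] d}"
      using x pow_in_cyc[of "x [^] d" "m div d"] by (simp add: nat_pow_pow)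
    have z2: "z = x [^] (d * (m div d)) \<otimes> x [^] (m mod d)"
      using x m by (simp add: nat_pow_mult)
    then have "x [^] (m mod d) = inv (x [^] (d * (m div d))) \<otimes> z"
      using x by (metis inv_solve_left nat_pow_closed m_closed)
    then have "x [^] (m mod d) \<in> K"
      using e gen z K(1) by (auto intro: subgroup.m_closed subgroup.m_inv_closed)
    then have "m mod d = 0" using least[of "m mod d"] d by auto
    then show "z \<in> generate G {x [^] d}" using e z2 x by simp
  qed
  then have "K = generate G {x [^] d}" using gen by blast
  then show ?thesis using x cyc_in_cyclic_subgroups by simp
qed

lemma cyclic_subgroups_Int:
  assumes "C \<in> cyclic_subgroups G" "D \<in> cyclic_subgroups G"
  shows "C \<inter> D \<in> cyclic_subgroups G"
proof -
  obtain x where x: "x \<in> carrier G" "C = generate G {x}" using assms by (auto simp: cyclic_subgroups_eq)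
  have "subgroup (C \<inter> D) G"
    using assms by (auto simp: cyclic_subgroups_def intro: subgroups_Inter_pair)
  then show ?thesis using subgroup_of_cyclic x by blast
qed

end

section \<open>Characters on powers\<close>

lemma not_coprime_prime_dvd: "prime p \<Longrightarrow> p dvd n \<Longrightarrow> \<not> coprime p n" for p n :: nat
  using coprime_absorb_left not_prime_unit by blast

context finite_group
begin

definition power_closed :: "'a set \<Rightarrow> bool" where
  "power_closed S \<longleftrightarrow> S \<subseteq> carrier G \<and> (\<forall>x\<in>S. \<forall>t::nat. x [^] t \<in> S)"

text \<open>A homomorphism into the multiplicative group of the complex numbers as far as powers of a single
  element are concerned; nothing is asked of products of elements that do not lie in a common cyclic
  subgroup. The second condition makes it injective on every cyclic subgroup.\<close>

definition power_character_on :: "'a set \<Rightarrow> ('a \<Rightarrow> complex) \<Rightarrow> bool" where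
  "power_character_on S \<chi> \<longleftrightarrow>
     (\<forall>x\<in>S. \<forall>t::nat. \<chi> (x [^] t) = \<chi> x ^ t) \<and> (\<forall>x\<in>S. \<chi> x = 1 \<longrightarrow> x = \<one>)"

lemma power_character_on_one:
  assumes "power_closed S" "power_character_on S \<chi>" "x \<in> S"
  shows "\<chi> \<one> = 1"
proof -
  have "\<chi> (x [^] (0::nat)) = \<chi> x ^ 0" using assms unfolding power_character_on_def by blast
  then show ?thesis by simp
qed

text \<open>The powers of $g$ that are not generators of $\langle g \rangle$ already have values, and $w$ is
  a value for $g$ consistent with all of these. The order $n$ of $g$ decides how $w$ is found. If
  $n$ is a power $p^k$ with $k \geq 2$, the condition only concerns $g^p$, and any $p$-th root of
  $\chi(g^p)$ will do. If two different primes $p$ and $q$ divide $n$, then $g$ is a product of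
  powers of $g^p$ and $g^q$, which prescribes $w$. For prime $n$ nothing but $w^n = 1$ is asked,
  and a root other than $1$ has to be taken.\<close>

lemma ex_root_for_generator:
  assumes S: "power_closed S" and \<chi>: "power_character_on S \<chi>"
    and g: "g \<in> carrier G"
    and low: "\<And>t. \<not> coprime t (ord g) \<Longrightarrow> g [^] t \<in> S"
  shows "\<exists>w. (\<forall>t. \<not> coprime t (ord g) \<longrightarrow> \<chi> (g [^] t) = w ^ t) \<and>
     (ord g = 1 \<longrightarrow> w = 1) \<and> (prime (ord g) \<longrightarrow> w \<noteq> 1)"
proof -
  let ?n = "ord g"
  have n0: "0 < ?n" using ord_pos g by blast
  have hom: "\<chi> ((g [^] t) [^] s) = \<chi> (g [^] t) ^ s" if "\<not> coprime t ?n" for t s :: nat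
    using low[OF that] \<chi> unfolding power_character_on_def by blast
  have one: "\<chi> \<one> = 1" if "?n \<noteq> 1"
  proof -
    have "\<one> \<in> S" using low[of ?n] that g by simp
    then show ?thesis using power_character_on_one S \<chi> by blast
  qed
  consider "?n = 1" | "prime ?n" | p where "prime p" "?n \<noteq> p" "p dvd ?n" "\<And>q. prime q \<Longrightarrow> q dvd ?n \<Longrightarrow> q = p"
    | p q where "prime p" "prime q" "p \<noteq> q" "p dvd ?n" "q dvd ?n"
    by (metis prime_factor_nat)
  then show ?thesis
  proof cases
    case 1
    then show ?thesis by (intro exI[of _ 1]) simp
  next
    case 2
    let ?w = "cis (2 * pi / ?n)"
    have "?n > 1" using 2 prime_gt_1_nat by blast
    have w: "?w ^ ?n = 1" using n0 by (simp add: DeMoivre)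
    have "?w \<noteq> 1"
    proof
      assume "?w = 1"
      then have "cis (2 * pi * real 1 / real ?n) = cis (2 * pi * real 0 / real ?n)" by simp
      moreover have "inj_on (\<lambda>k. cis (2 * pi * real k / real ?n)) {..<?n}"
        using bij_betw_roots_unity[OF n0] by (simp add: bij_betw_def)
      ultimately have "(1::nat) = 0" using \<open>?n > 1\<close> n0 by (elim inj_onD) auto
      then show False by simp
    qed
    moreover have "\<chi> (g [^] t) = ?w ^ t" if t: "\<not> coprime t ?n" for t
    proof -
      have "?n dvd t" using t 2 by (metis coprime_commute prime_imp_coprime)
      then obtain s where s: "t = ?n * s" by blast
      have "g [^] t = \<one>" using g s by (simp add: pow_eq_id)
      moreover have "?w ^ t = 1" using w s by (simp add: power_mult)
      ultimately show ?thesis using one \<open>?n > 1\<close> by simp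
    qed
    ultimately show ?thesis using \<open>?n > 1\<close> by (intro exI[of _ ?w]) auto
  next
    case 3
    have np: "\<not> prime ?n" using 3 by (metis dvd_refl)
    have p: "\<not> coprime p ?n" using 3 not_coprime_prime_dvd by blast
    obtain w where w: "w ^ p = \<chi> (g [^] p)"
    proof -
      have "p > 0" using 3 prime_gt_0_nat by blast
      then have "(rcis (root p (cmod (\<chi> (g [^] p)))) (Arg (\<chi> (g [^] p)) / p)) ^ p = \<chi> (g [^] p)"
        by (simp add: DeMoivre2 rcis_cmod_Arg)
      then show ?thesis using that by blast
    qed
    have "\<chi> (g [^] t) = w ^ t" if t: "\<not> coprime t ?n" for t
    proof -
      have "gcd t ?n \<noteq> 1" using t by (simp add: coprime_iff_gcd_eq_1)
      then obtain q where "prime q" "q dvd gcd t ?n" using prime_factor_nat by blast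
      then have "p dvd t" using 3(4)[of q] by auto
      then obtain s where s: "t = p * s" by blast
      then show ?thesis using hom[OF p, of s] w g by (simp add: nat_pow_pow power_mult)
    qed
    moreover have "?n \<noteq> 1" using 3(1,3) by auto
    ultimately show ?thesis using np by blast
  next
    case 4
    have np: "\<not> prime ?n" using 4 by (metis primes_dvd_imp_eq)
    have p: "\<not> coprime p ?n" "\<not> coprime q ?n" using 4 not_coprime_prime_dvd by blast+
    obtain u v where uv: "[p * u + q * v = 1] (mod ?n)"
    proof -
      have "coprime p q" using 4 primes_coprime by blast
      then obtain u where "[p * u = 1] (mod q)" using cong_solve_coprime_nat by auto
      then obtain c where c: "int (p * u) - 1 = int q * c"
        by (metis cong_iff_dvd_diff cong_int_iff dvdE of_nat_1)
      \<comment> \<open>the Bezout coefficient $-c$ may be negative and is replaced by its residue\<close>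
      define v where "v = nat ((- c) mod int ?n)"
      have "[int p * int u + int q * int v = int p * int u + int q * (-c)] (mod int ?n)"
        unfolding v_def using n0 by (intro cong_add cong_mult) (auto simp: cong_def)
      moreover have "int p * int u + int q * (-c) = 1" using c by (simp add: algebra_simps)
      ultimately have "[int (p * u + q * v) = int 1] (mod int ?n)" by simp
      then show ?thesis using that cong_int_iff by blast
    qed
    define w where "w = \<chi> (g [^] p) ^ u * \<chi> (g [^] q) ^ v"
    have "\<chi> (g [^] t) = w ^ t" if t: "\<not> coprime t ?n" for t
    proof -
      have "w ^ t = \<chi> (g [^] p) ^ (u * t) * \<chi> (g [^] q) ^ (v * t)"
        unfolding w_def by (simp add: power_mult_distrib power_mult)
      also have "\<dots> = \<chi> (g [^] (p * (u * t))) * \<chi> (g [^] (q * (v * t)))"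
        using hom[OF p(1), of "u * t"] hom[OF p(2), of "v * t"] g by (simp add: nat_pow_pow)
      also have "\<dots> = \<chi> ((g [^] t) [^] (p * u)) * \<chi> ((g [^] t) [^] (q * v))"
        using g by (simp add: nat_pow_pow mult.commute mult.left_commute)
      also have "\<dots> = \<chi> (g [^] t) ^ (p * u + q * v)"
        using hom[OF t] by (simp add: power_add)
      also have "\<dots> = \<chi> (g [^] (t * (p * u + q * v)))"
        using hom[OF t, of "p * u + q * v"] g by (simp add: nat_pow_pow)
      also have "g [^] (t * (p * u + q * v)) = g [^] t"
        using g uv pow_eq_iff_cong cong_scalar_left[OF uv, of t] by simp
      finally show ?thesis by simp
    qed
    moreover have "?n \<noteq> 1" using 4(1,4) by auto
    ultimately show ?thesis using np by blast
  qed
qed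

text \<open>Every generator $g^t$ of $\langle g \rangle$ lies outside $S$, as $g$ is a power of it, and it
  receives the value $w^t$. If a nontrivial element had the value $1$, so would its powers of
  prime order; these lie in $S$ unless $g$ itself has prime order.\<close>

lemma power_character_extend:
  assumes S: "power_closed S" and \<chi>: "power_character_on S \<chi>"
    and g: "g \<in> carrier G" "g \<notin> S"
    and low: "\<And>t. \<not> coprime t (ord g) \<Longrightarrow> g [^] t \<in> S"
  shows "\<exists>\<chi>'. power_character_on (S \<union> generate G {g}) \<chi>'"
proof -
  let ?n = "ord g"
  obtain w where w: "\<And>t. \<not> coprime t ?n \<Longrightarrow> \<chi> (g [^] t) = w ^ t" "?n = 1 \<Longrightarrow> w = 1" "prime ?n \<Longrightarrow> w \<noteq> 1"
    using ex_root_for_generator[OF S \<chi> g(1) low] by blast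
  have new: "g [^] t \<notin> S" if t: "coprime t ?n" for t
  proof
    assume "g [^] t \<in> S"
    moreover have "ord (g [^] t) = ?n" using pow_ord_eq_ord_iff[OF fin] g t by blast
    then have "g \<in> generate G {g [^] t}"
      using cyc_iff_dvd[of g g "g [^] t"] g cyc_self pow_in_cyc by simp
    then obtain s :: nat where "g = (g [^] t) [^] s" using g cyc_eq by auto
    ultimately show False using S g unfolding power_closed_def by metis
  qed
  have wn: "w ^ a = w ^ b" if "coprime a ?n" "g [^] a = g [^] b" for a b
  proof (cases "?n = 1")
    case False
    have "\<not> coprime ?n ?n" using False by simp
    from w(1)[OF this] have "w ^ ?n = \<chi> \<one>" using g by simp
    moreover have "\<one> \<in> S" using low[of ?n] False g by simp
    ultimately have "w ^ ?n = 1" using power_character_on_one S \<chi> by simp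
    moreover have c: "[a = b] (mod ?n)" using that g pow_eq_iff_cong by blast
    ultimately show ?thesis
      by (metis cong_def div_mult_mod_eq mult.commute power_add power_mult power_one)
  next
    case True
    then show ?thesis using w(2) by simp
  qed
  \<comment> \<open>outside $S$ the exponent is not unique, but $w^t$ does not depend on it\<close>
  define \<chi>' where "\<chi>' x = (if x \<in> S then \<chi> x else w ^ (SOME t::nat. x = g [^] t))" for x
  have gw: "\<chi>' (g [^] t) = w ^ t" for t
  proof (cases "coprime t ?n")
    case True
    have "g [^] t = g [^] (SOME s::nat. g [^] t = g [^] s)"
      by (rule someI_ex[of "\<lambda>s::nat. g [^] t = g [^] s"]) blast
    from wn[OF True this] show ?thesis using new[OF True] unfolding \<chi>'_def by metis
  next
    case False
    then show ?thesis using w(1)[OF False] low[OF False] unfolding \<chi>'_def by simp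
  qed
  have "power_character_on (S \<union> generate G {g}) \<chi>'"
    unfolding power_character_on_def
  proof (intro conjI ballI allI impI)
    fix x and t :: nat assume x: "x \<in> S \<union> generate G {g}"
    show "\<chi>' (x [^] t) = \<chi>' x ^ t"
    proof (cases "x \<in> S")
      case True
      then show ?thesis using S \<chi> unfolding power_closed_def power_character_on_def \<chi>'_def by auto
    next
      case False
      then obtain s :: nat where s: "x = g [^] s" using x g cyc_eq by auto
      then show ?thesis using gw[of s] gw[of "s * t"] g by (simp add: nat_pow_pow power_mult)
    qed
  next
    fix x assume x: "x \<in> S \<union> generate G {g}" and 1: "\<chi>' x = 1"
    show "x = \<one>"
    proof (cases "x \<in> S")
      case True
      then show ?thesis using 1 \<chi> unfolding power_character_on_def \<chi>'_def by auto
    next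
      case False
      then obtain s :: nat where s: "x = g [^] s" using x g cyc_eq by auto
      have "coprime s ?n" using low False s by blast
      then obtain r where r: "[s * r = 1] (mod ?n)" using cong_solve_coprime_nat by auto
      have "w ^ s = 1" using gw[of s] 1 s by simp
      have gr: "g [^] (s * r) = g [^] (1::nat)" using r g pow_eq_iff_cong by blast
      have w1: "w = 1" using gw[of "s * r"] gw[of 1] gr \<open>w ^ s = 1\<close> by (simp add: power_mult)
      have "\<not> prime ?n" using w(3) w1 by blast
      have "?n = 1"
      proof (rule ccontr)
        assume "?n \<noteq> 1"
        then obtain p where p: "prime p" "p dvd ?n" using prime_factor_nat by blast
        then have "\<not> coprime p ?n" by (rule not_coprime_prime_dvd)
        then have "g [^] p \<in> S" "\<chi> (g [^] p) = 1" using low w(1) w1 by auto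
        then have "g [^] p = \<one>" using \<chi> unfolding power_character_on_def by blast
        then have "?n dvd p" using g pow_eq_id by blast
        then show False using p \<open>\<not> prime ?n\<close> by (metis dvd_antisym)
      qed
      then show ?thesis using s g ord_eq_1 by (metis nat_pow_one)
    qed
  qed
  then show ?thesis by blast
qed

text \<open>Cyclic subgroups are added by increasing order, so that the proper subgroups of the next cyclic
  group are treated already. Minimality of the order of $g$ among the remaining elements gives
  exactly this.\<close>

lemma ex_power_character: "\<exists>\<chi>. power_character_on (carrier G) \<chi>"
proof -
  have "\<exists>\<chi>. power_character_on (carrier G) \<chi>" if "power_closed S" "power_character_on S \<chi>" for S \<chi>
    using that
  proof (induction "card (carrier G - S)" arbitrary: S \<chi> rule: less_induct)
    case less
    have sub: "S \<subseteq> carrier G" using less.prems unfolding power_closed_def by blast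
    show ?case
    proof (cases "S = carrier G")
      case True
      then show ?thesis using less.prems by blast
    next
      case False
      then obtain g where g: "g \<in> carrier G - S" "\<And>h. h \<in> carrier G - S \<Longrightarrow> ord g \<le> ord h"
        using sub arg_min_nat_lemma[of "\<lambda>x. x \<in> carrier G - S" _ ord]
        by (metis DiffI subset_antisym subsetI)
      have low: "g [^] t \<in> S" if "\<not> coprime t (ord g)" for t :: nat
      proof (rule ccontr)
        assume "g [^] t \<notin> S"
        then have "ord g \<le> ord (g [^] t)" using g by auto
        moreover have "ord (g [^] t) dvd ord g" using ord_dvd_of_cyc pow_in_cyc g by blast
        ultimately have "ord (g [^] t) = ord g"
          using ord_pos g by (metis DiffE dvd_imp_le le_antisym)
        then show False using that pow_ord_eq_ord_iff[OF fin] g by blast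
      qed
      obtain \<chi>' where \<chi>': "power_character_on (S \<union> generate G {g}) \<chi>'"
        using power_character_extend[OF less.prems _ _ low] g by blast
      have "power_closed (S \<union> generate G {g})"
        using less.prems(1) g cyc_subset_carrier[of g] unfolding power_closed_def
        by (auto simp: cyc_eq nat_pow_pow)
      moreover have "card (carrier G - (S \<union> generate G {g})) < card (carrier G - S)"
        using g cyc_self[of g] fin by (intro psubset_card_mono) auto
      ultimately show ?thesis using less.hyps \<chi>' by blast
    qed
  qed
  moreover have "power_closed {}" "power_character_on {} (\<lambda>_. 1)"
    by (auto simp: power_closed_def power_character_on_def)
  ultimately show ?thesis by blast
qed

end

section \<open>Power-preserving bijections from families of cyclic subgroups\<close>

context finite_group
begin

text \<open>This is the reason for using complex values: the image of a cyclic subgroup depends only on its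
  order, so characters of different groups can be compared.\<close>

lemma power_character_bij:
  assumes \<chi>: "power_character_on (carrier G) \<chi>" and C: "C \<in> cyclic_subgroups G"
  shows "bij_betw \<chi> C {z. z ^ card C = 1}"
proof -
  obtain x where x: "x \<in> carrier G" "C = generate G {x}" using C by (auto simp: cyclic_subgroups_eq)
  have hom: "\<chi> (y [^] t) = \<chi> y ^ t" if "y \<in> carrier G" for y and t :: nat
    using \<chi> that unfolding power_character_on_def by blast
  have one: "\<chi> \<one> = 1" using hom[of \<one> 0] by simp
  have nz: "\<chi> x \<noteq> 0"
    using hom[OF x(1), of "ord x"] one x ord_pos[OF x(1)] by (auto simp: power_0_left)
  have *: "x [^] a = x [^] b" if "\<chi> (x [^] a) = \<chi> (x [^] b)" "a \<le> b" for a b :: nat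
  proof -
    have "\<chi> x ^ a * \<chi> x ^ (b - a) = \<chi> x ^ a * 1"
      using that hom x by (metis le_add_diff_inverse mult_1_right power_add)
    then have "\<chi> (x [^] (b - a)) = 1" using nz hom x by simp
    then have "x [^] (b - a) = \<one>" using \<chi> x unfolding power_character_on_def by simp
    then show ?thesis using that x nat_pow_mult[of x a "b - a"] by simp
  qed
  have inj: "inj_on \<chi> C"
  proof (rule inj_onI)
    fix u v assume uv: "u \<in> C" "v \<in> C" "\<chi> u = \<chi> v"
    then obtain a b :: nat where "u = x [^] a" "v = x [^] b" using x cyc_eq by auto
    then show "u = v" using *[of a b] *[of b a] uv by (metis nat_le_linear)
  qed
  have n: "0 < card C" "card C = ord x" using x card_cyc ord_pos by auto
  have "\<chi> ` C \<subseteq> {z. z ^ card C = 1}"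
  proof clarify
    fix u assume u: "u \<in> C"
    then have "u \<in> carrier G" "u [^] card C = \<one>"
      using x n cyc_carrier ord_dvd_of_cyc pow_eq_id by auto
    then show "\<chi> u ^ card C = 1" using hom one by metis
  qed
  moreover have "card (\<chi> ` C) = card {z::complex. z ^ card C = 1}"
    using card_image[OF inj] card_roots_unity_eq[OF n(1)] by simp
  ultimately have "\<chi> ` C = {z. z ^ card C = 1}"
    using finite_roots_unity[of "card C"] n by (intro card_subset_eq) auto
  then show ?thesis using inj by (simp add: bij_betw_def)
qed

end

text \<open>The set $A_i \cap A_j$ is cyclic of the same order as $B_i \cap B_j$, so $\chi(g)$ is attained by
  $\psi$ on $B_i \cap B_j$ whenever $g \in A_i \cap A_j$. An element found inside both $B_i$ and
  $B_j$ shows that the elements found for $i$ and for $j$ agree.\<close>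

lemma ex1_matching_element:
  assumes G: "finite_group G" and H: "finite_group H"
    and \<chi>: "finite_group.power_character_on G (carrier G) \<chi>"
    and \<psi>: "finite_group.power_character_on H (carrier H) \<psi>"
    and A: "\<And>i. i \<in> I \<Longrightarrow> A i \<in> cyclic_subgroups G"
    and B: "\<And>i. i \<in> I \<Longrightarrow> B i \<in> cyclic_subgroups H"
    and card: "\<And>i j. i \<in> I \<Longrightarrow> j \<in> I \<Longrightarrow> card (A i \<inter> A j) = card (B i \<inter> B j)"
    and cov: "g \<in> (\<Union>i\<in>I. A i)"
  shows "\<exists>!h. \<exists>i\<in>I. g \<in> A i \<and> h \<in> B i \<and> \<psi> h = \<chi> g"
proof -
  have ex: "\<exists>h. h \<in> B i \<inter> B j \<and> \<psi> h = \<chi> g" if "i \<in> I" "j \<in> I" "g \<in> A i \<inter> A j" for i j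
  proof -
    have "bij_betw \<chi> (A i \<inter> A j) {z. z ^ card (A i \<inter> A j) = 1}"
      using that by (intro finite_group.power_character_bij[OF G \<chi>] finite_group.cyclic_subgroups_Int[OF G] A)
    moreover have "bij_betw \<psi> (B i \<inter> B j) {z. z ^ card (B i \<inter> B j) = 1}"
      using that by (intro finite_group.power_character_bij[OF H \<psi>] finite_group.cyclic_subgroups_Int[OF H] B)
    ultimately have "\<chi> g \<in> \<psi> ` (B i \<inter> B j)"
      using that card[of i j] unfolding bij_betw_def by (metis imageI)
    then show ?thesis by auto
  qed
  have inj: "inj_on \<psi> (B i)" if "i \<in> I" for i
    using finite_group.power_character_bij[OF H \<psi> B[OF that]] by (simp add: bij_betw_def)
  obtain i where i: "i \<in> I" "g \<in> A i" using cov by blast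
  then obtain h where h: "h \<in> B i" "\<psi> h = \<chi> g" using ex[of i i] by auto
  show ?thesis
  proof (rule ex1I[of _ h])
    fix h' assume "\<exists>i\<in>I. g \<in> A i \<and> h' \<in> B i \<and> \<psi> h' = \<chi> g"
    then obtain j where j: "j \<in> I" "g \<in> A j" "h' \<in> B j" "\<psi> h' = \<chi> g" by blast
    then obtain h'' where "h'' \<in> B i \<inter> B j" "\<psi> h'' = \<chi> g" using ex[of i j] i by auto
    then show "h' = h" using inj i j h by (metis IntE inj_onD)
  qed (use i h in blast)
qed

text \<open>With $N = |G|\,|H|$ one and the same natural exponent replaces $t$ in both groups.\<close>

lemma (in group) int_pow_eq_nat_pow:
  assumes "x \<in> carrier G" "ord x dvd N" "0 < N"
  shows "x [^] (t::int) = x [^] nat (t mod int N)"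
proof -
  have "int (ord x) dvd (t mod int N - t)"
    using assms(2) by (meson dvd_trans int_dvd_int_iff mod_eq_dvd_iff mod_mod_trivial)
  then have "x [^] t = x [^] (t mod int N)" using int_pow_eq[OF assms(1)] by blast
  then show ?thesis using assms(3) by (simp flip: int_pow_int)
qed

lemma sim2_natI:
  assumes G: "finite_group G" and H: "finite_group H"
    and \<phi>: "bij_betw \<phi> (carrier G) (carrier H)"
    and hom: "\<And>g t. g \<in> carrier G \<Longrightarrow> \<phi> (g [^]\<^bsub>G\<^esub> (t::nat)) = \<phi> g [^]\<^bsub>H\<^esub> t"
  shows "sim2 G H"
proof -
  interpret G: finite_group G by fact
  interpret H: finite_group H by fact
  let ?N = "order G * order H"
  have N: "0 < ?N" using G.fin H.fin G.order_gt_0_iff_finite H.order_gt_0_iff_finite by simp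
  have "\<phi> (g [^]\<^bsub>G\<^esub> t) = \<phi> g [^]\<^bsub>H\<^esub> t" if g: "g \<in> carrier G" for g and t :: int
  proof -
    have h: "\<phi> g \<in> carrier H" using \<phi> g by (auto simp: bij_betw_def)
    have "G.ord g dvd ?N" "H.ord (\<phi> g) dvd ?N"
      using G.ord_dvd_group_order[OF g] H.ord_dvd_group_order[OF h] by auto
    then show ?thesis
      using G.int_pow_eq_nat_pow[OF g _ N] H.int_pow_eq_nat_pow[OF h _ N] hom[OF g] by simp
  qed
  then show ?thesis unfolding sim2_def using \<phi> by blast
qed

lemma sim2_nat:
  assumes "sim2 G H"
  shows "\<exists>\<phi>. bij_betw \<phi> (carrier G) (carrier H) \<and>
    (\<forall>g\<in>carrier G. \<forall>t::nat. \<phi> (g [^]\<^bsub>G\<^esub> t) = \<phi> g [^]\<^bsub>H\<^esub> t)"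
  using assms unfolding sim2_def by (metis int_pow_int)

text \<open>The relation between elements with equal character values in corresponding members of the families
  is functional in both directions by the previous uniqueness lemma, applied once to the pair $(G,H)$
  and once to $(H,G)$, so it is the graph of a bijection.\<close>

lemma sim2_if_matching_families:
  assumes G: "finite_group G" and H: "finite_group H"
    and A: "\<And>i. i \<in> I \<Longrightarrow> A i \<in> cyclic_subgroups G"
    and B: "\<And>i. i \<in> I \<Longrightarrow> B i \<in> cyclic_subgroups H"
    and card: "\<And>i j. i \<in> I \<Longrightarrow> j \<in> I \<Longrightarrow> card (A i \<inter> A j) = card (B i \<inter> B j)"
    and covG: "(\<Union>i\<in>I. A i) = carrier G"
    and covH: "(\<Union>i\<in>I. B i) = carrier H"
  shows "sim2 G H"
proof -
  interpret G: finite_group G by fact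
  interpret H: finite_group H by fact
  obtain \<chi> where \<chi>: "G.power_character_on (carrier G) \<chi>" using G.ex_power_character by blast
  obtain \<psi> where \<psi>: "H.power_character_on (carrier H) \<psi>" using H.ex_power_character by blast
  define R where "R g h \<longleftrightarrow> (\<exists>i\<in>I. g \<in> A i \<and> h \<in> B i \<and> \<psi> h = \<chi> g)" for g h
  have R1: "\<exists>!h. R g h" if "g \<in> carrier G" for g
    unfolding R_def using that covG by (intro ex1_matching_element[OF G H \<chi> \<psi> A B card]) auto
  have R2: "\<exists>!g. R g h" if "h \<in> carrier H" for h
  proof -
    have "\<exists>!g. \<exists>i\<in>I. h \<in> B i \<and> g \<in> A i \<and> \<chi> g = \<psi> h"
      using that covH by (intro ex1_matching_element[OF H G \<psi> \<chi> B A card[symmetric]]) auto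
    then show ?thesis unfolding R_def by (metis (no_types, lifting))
  qed
  have Rc: "g \<in> carrier G \<and> h \<in> carrier H" if "R g h" for g h
    using that covG covH unfolding R_def by blast
  define \<phi> where "\<phi> g = (THE h. R g h)" for g
  have \<phi>R: "R g (\<phi> g)" if "g \<in> carrier G" for g
    unfolding \<phi>_def using R1[OF that] by (rule theI')
  have \<phi>eq: "\<phi> g = h" if "R g h" for g h
    using R1 Rc \<phi>R that by blast
  have bij: "bij_betw \<phi> (carrier G) (carrier H)"
    unfolding bij_betw_def
  proof (intro conjI inj_onI subset_antisym subsetI)
    fix x y assume "x \<in> carrier G" "y \<in> carrier G" "\<phi> x = \<phi> y"
    then show "x = y" using \<phi>R[of x] \<phi>R[of y] R2 Rc by metis
  next
    fix h assume "h \<in> carrier H"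
    then show "h \<in> \<phi> ` carrier G" using R2 \<phi>eq Rc by (metis imageI)
  qed (use \<phi>R Rc in blast)
  have "\<phi> (g [^]\<^bsub>G\<^esub> t) = \<phi> g [^]\<^bsub>H\<^esub> t" if g: "g \<in> carrier G" for g and t :: nat
  proof (rule \<phi>eq)
    obtain i where i: "i \<in> I" "g \<in> A i" "\<phi> g \<in> B i" "\<psi> (\<phi> g) = \<chi> g"
      using \<phi>R[OF g] unfolding R_def by blast
    have h: "\<phi> g \<in> carrier H" using \<phi>R[OF g] Rc by blast
    have "\<psi> (\<phi> g [^]\<^bsub>H\<^esub> t) = \<chi> (g [^]\<^bsub>G\<^esub> t)"
      using \<chi> \<psi> g h i(4) unfolding G.power_character_on_def H.power_character_on_def by simp
    then show "R (g [^]\<^bsub>G\<^esub> t) (\<phi> g [^]\<^bsub>H\<^esub> t)"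
      using i G.cyclic_subgroups_pow[OF A] H.cyclic_subgroups_pow[OF B] unfolding R_def by blast
  qed
  then show ?thesis using sim2_natI[OF G H bij] by blast
qed

text \<open>The form used for power graphs: a bijection that merely carries enough cyclic subgroups to cyclic
  subgroups. It need not preserve any powers itself, and the bijection obtained is in general a
  different one.\<close>

lemma sim2_if_bij_on_cyclic_cover:
  assumes G: "finite_group G" and H: "finite_group H"
    and f: "bij_betw f (carrier G) (carrier H)"
    and A: "\<And>i. i \<in> I \<Longrightarrow> A i \<in> cyclic_subgroups G"
    and fA: "\<And>i. i \<in> I \<Longrightarrow> f ` A i \<in> cyclic_subgroups H"
    and cov: "(\<Union>i\<in>I. A i) = carrier G"
  shows "sim2 G H"
proof (rule sim2_if_matching_families[OF G H A fA])
  have inj: "inj_on f (carrier G)" and surj: "f ` carrier G = carrier H"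
    using f by (auto simp: bij_betw_def)
  fix i j assume ij: "i \<in> I" "j \<in> I"
  then have sub: "A i \<subseteq> carrier G" "A j \<subseteq> carrier G" using cov by auto
  have "f ` A i \<inter> f ` A j = f ` (A i \<inter> A j)" using inj_on_image_Int[OF inj sub] by simp
  moreover have "inj_on f (A i \<inter> A j)" using inj_on_subset[OF inj] sub by blast
  ultimately show "card (A i \<inter> A j) = card (f ` A i \<inter> f ` A j)" by (simp add: card_image)
next
  show "(\<Union>i\<in>I. f ` A i) = carrier H"
    using f cov unfolding bij_betw_def by (metis image_UN)
qed (use cov in auto)

section \<open>The poset of cyclic subgroups\<close>

lemma pverts_cyclic_subgroup_digraph: "pverts (cyclic_subgroup_digraph G) = cyclic_subgroups G"
  by (simp add: cyclic_subgroup_digraph_def)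

lemma cyclic_subgroup_digraph_arc_iff:
  assumes "C \<in> cyclic_subgroups G" "D \<in> cyclic_subgroups G"
  shows "(C, D) \<in> parcs (cyclic_subgroup_digraph G) \<longleftrightarrow> D \<subset> C"
  using assms by (simp add: cyclic_subgroup_digraph_def)

lemma sim3_iff:
  "sim3 G H \<longleftrightarrow> (\<exists>f. bij_betw f (cyclic_subgroups G) (cyclic_subgroups H) \<and>
     (\<forall>C\<in>cyclic_subgroups G. \<forall>D\<in>cyclic_subgroups G. D \<subset> C \<longleftrightarrow> f D \<subset> f C) \<and>
     (\<forall>C\<in>cyclic_subgroups G. card (f C) = card C))"
  unfolding sim3_def
    weighted_digraph_iso_iff[OF pair_wf_cyclic_subgroup_digraph pair_wf_cyclic_subgroup_digraph]
    pverts_cyclic_subgroup_digraph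
  by (intro arg_cong[of _ _ Ex] ext conj_cong ball_cong refl)
    (simp add: cyclic_subgroup_digraph_arc_iff bij_betw_apply)

text \<open>An isomorphism of posets preserves meets. As the intersection of two cyclic subgroups is cyclic,
  it is their meet, and so its order is preserved.\<close>

lemma sim2_if_sim3:
  assumes G: "finite_group G" and H: "finite_group H" and "sim3 G H"
  shows "sim2 G H"
proof -
  interpret G: finite_group G by fact
  interpret H: finite_group H by fact
  obtain f where f: "bij_betw f (cyclic_subgroups G) (cyclic_subgroups H)"
    and ord: "\<forall>C\<in>cyclic_subgroups G. \<forall>D\<in>cyclic_subgroups G. D \<subset> C \<longleftrightarrow> f D \<subset> f C"
    and card: "\<forall>C\<in>cyclic_subgroups G. card (f C) = card C"
    using \<open>sim3 G H\<close> unfolding sim3_iff by metis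
  have fH: "f C \<in> cyclic_subgroups H" if "C \<in> cyclic_subgroups G" for C
    using f that by (auto simp: bij_betw_def)
  have le: "D \<subseteq> C \<longleftrightarrow> f D \<subseteq> f C" if "C \<in> cyclic_subgroups G" "D \<in> cyclic_subgroups G" for C D
    using ord[rule_format, OF that] inj_on_eq_iff[OF bij_betw_imp_inj_on[OF f] that]
    unfolding subset_iff_psubset_eq by blast
  have Int: "f (C \<inter> D) = f C \<inter> f D" if CD: "C \<in> cyclic_subgroups G" "D \<in> cyclic_subgroups G" for C D
  proof
    have CD': "C \<inter> D \<in> cyclic_subgroups G" using CD G.cyclic_subgroups_Int by blast
    then show "f (C \<inter> D) \<subseteq> f C \<inter> f D" using le CD by blast
    have "f C \<inter> f D \<in> cyclic_subgroups H" using H.cyclic_subgroups_Int fH CD by blast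
    then obtain E where E: "E \<in> cyclic_subgroups G" "f E = f C \<inter> f D"
      using f unfolding bij_betw_def by (metis imageE)
    then have "E \<subseteq> C \<inter> D" using le CD by auto
    then show "f C \<inter> f D \<subseteq> f (C \<inter> D)" using le[OF CD' E(1)] E(2) by simp
  qed
  show ?thesis
  proof (rule sim2_if_matching_families[OF G H, where A = "\<lambda>C. C" and B = f and I = "cyclic_subgroups G"])
    fix C D assume "C \<in> cyclic_subgroups G" "D \<in> cyclic_subgroups G"
    then show "card (C \<inter> D) = card (f C \<inter> f D)"
      using Int card G.cyclic_subgroups_Int by metis
  next
    show "(\<Union>C\<in>cyclic_subgroups G. f C) = carrier H"
      using f H.Union_cyclic_subgroups by (simp add: bij_betw_def)
  qed (use fH G.Union_cyclic_subgroups in auto)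
qed

lemma power_map_image_cyc:
  assumes "finite_group G" "finite_group H"
    and \<phi>: "bij_betw \<phi> (carrier G) (carrier H)"
    and hom: "\<forall>g\<in>carrier G. \<forall>t::nat. \<phi> (g [^]\<^bsub>G\<^esub> t) = \<phi> g [^]\<^bsub>H\<^esub> t"
    and g: "g \<in> carrier G"
  shows "\<phi> ` generate G {g} = generate H {\<phi> g}"
proof -
  have "\<phi> g \<in> carrier H" using \<phi> g by (auto simp: bij_betw_def)
  then show ?thesis
    using assms finite_group.cyc_eq[of G g] finite_group.cyc_eq[of H "\<phi> g"] by (auto simp: image_image)
qed

lemma sim3_if_sim2:
  assumes G: "finite_group G" and H: "finite_group H" and "sim2 G H"
  shows "sim3 G H"
proof -
  interpret G: finite_group G by fact
  interpret H: finite_group H by fact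
  obtain \<phi> where \<phi>: "bij_betw \<phi> (carrier G) (carrier H)"
    and hom: "\<forall>g\<in>carrier G. \<forall>t::nat. \<phi> (g [^]\<^bsub>G\<^esub> t) = \<phi> g [^]\<^bsub>H\<^esub> t"
    using sim2_nat[OF \<open>sim2 G H\<close>] by blast
  have inj: "inj_on \<phi> (carrier G)" and surj: "\<phi> ` carrier G = carrier H"
    using \<phi> by (auto simp: bij_betw_def)
  have sub: "\<phi> ` C \<subseteq> \<phi> ` D \<longleftrightarrow> C \<subseteq> D" if "C \<in> cyclic_subgroups G" "D \<in> cyclic_subgroups G" for C D
    using inj_on_image_mem_iff[OF inj] that[THEN G.cyclic_subgroups_subset] by blast
  have "bij_betw ((`) \<phi>) (cyclic_subgroups G) (cyclic_subgroups H)"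
    unfolding bij_betw_def
  proof
    show "inj_on ((`) \<phi>) (cyclic_subgroups G)"
    proof (rule inj_onI)
      fix C D assume CD: "C \<in> cyclic_subgroups G" "D \<in> cyclic_subgroups G" "\<phi> ` C = \<phi> ` D"
      show "C = D" using sub[OF CD(1,2)] sub[OF CD(2,1)] CD(3) by simp
    qed
    have "(`) \<phi> ` cyclic_subgroups G = (\<lambda>g. generate H {\<phi> g}) ` carrier G"
      using power_map_image_cyc[OF G H \<phi> hom] unfolding G.cyclic_subgroups_eq image_image
      by (intro image_cong) auto
    also have "\<dots> = cyclic_subgroups H"
      unfolding H.cyclic_subgroups_eq surj[symmetric] image_image ..
    finally show "(`) \<phi> ` cyclic_subgroups G = cyclic_subgroups H" .
  qed
  moreover have "card (\<phi> ` C) = card C" if "C \<in> cyclic_subgroups G" for C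
    using inj_on_subset[OF inj G.cyclic_subgroups_subset[OF that]] by (rule card_image)
  ultimately show ?thesis
    unfolding sim3_iff using sub by (intro exI[of _ "(`) \<phi>"]) (simp add: less_le_not_le)
qed

section \<open>Divisors and totients\<close>

lemma only_prime_divisor_imp_primepow:
  fixes n :: nat
  assumes "1 < n" and "\<And>q. prime q \<Longrightarrow> q dvd n \<Longrightarrow> q = p"
  shows "primepow n"
proof -
  obtain q where q: "prime q" "q dvd n" using assms(1) prime_factor_nat[of n] by auto
  have qp: "q = p" using assms(2) q by blast
  obtain k where k: "n = p ^ multiplicity p n * k" "\<not> p dvd k"
    using multiplicity_decompose'[of n p] q qp assms(1) by (metis not_less_zero not_prime_unit)
  have "k = 1"
  proof (rule ccontr)
    assume "k \<noteq> 1"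
    then obtain r where "prime r" "r dvd k" using prime_factor_nat by blast
    then show False using assms(2)[of r] k by (metis dvd_mult)
  qed
  then have n: "n = p ^ multiplicity p n" using k by simp
  then have "multiplicity p n > 0" using assms(1) by (cases "multiplicity p n") auto
  then show ?thesis using n q qp unfolding primepow_def by blast
qed

text \<open>Take a prime $q$ dividing $n/m$ and the full power $Q$ of $q$ in $n$. Then $Q$ does not divide $m$,
  so $m$ divides $Q$ and is a nontrivial power of $q$. A prime divisor of $n$ comparable with $m$ can
  then only be $q$.\<close>

lemma primepow_if_divisors_comparable:
  fixes m n :: nat
  assumes "m dvd n" "m \<noteq> n" "m \<noteq> 1" "0 < n"
    and comp: "\<And>d. d dvd n \<Longrightarrow> d dvd m \<or> m dvd d"
  shows "primepow n"
proof -
  obtain k where k: "n = m * k" using assms(1) by blast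
  have "k \<noteq> 1" using k assms(2) by simp
  then obtain q where q: "prime q" "q dvd k" using prime_factor_nat by blast
  have m0: "m \<noteq> 0" "k \<noteq> 0" using k assms(4) by auto
  have "multiplicity q n = multiplicity q m + multiplicity q k"
    using q m0 unfolding k by (intro prime_elem_multiplicity_mult_distrib) auto
  moreover have "multiplicity q k > 0" using q m0 by (simp add: prime_multiplicity_gt_zero_iff)
  ultimately have "\<not> q ^ multiplicity q n dvd m"
    using m0 q by (subst power_dvd_iff_le_multiplicity) auto
  then have "m dvd q ^ multiplicity q n" using comp multiplicity_dvd by blast
  then obtain i where i: "m = q ^ i" using q divides_primepow_nat by blast
  then have "0 < i" using assms(3) by (cases i) auto
  have "r = q" if r: "prime r" "r dvd n" for r
    using comp[OF r(2)]
  proof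
    assume "r dvd m" then show ?thesis using i r q by (metis prime_dvd_power primes_dvd_imp_eq)
  next
    assume "m dvd r"
    then have "q dvd r" using i \<open>0 < i\<close> by (metis dvd_power dvd_trans)
    then show ?thesis using r q by (metis primes_dvd_imp_eq)
  qed
  moreover have "n \<noteq> 1" using assms(1,3) by auto
  then have "1 < n" using assms(4) by linarith
  ultimately show ?thesis using only_prime_divisor_imp_primepow by blast
qed

lemma divisors_of_primepow_comparable:
  fixes n :: nat
  assumes "primepow n" "a dvd n" "b dvd n"
  shows "a dvd b \<or> b dvd a"
proof -
  obtain p k where p: "prime p" "n = p ^ k" using assms(1) unfolding primepow_def by blast
  obtain i where i: "a = p ^ i" using assms(2) p divides_primepow_nat[OF p(1)] by auto
  obtain j where j: "b = p ^ j" using assms(3) p divides_primepow_nat[OF p(1)] by auto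
  show ?thesis unfolding i j by (cases "i \<le> j") (simp_all add: le_imp_power_dvd)
qed

lemma primepow_dvd:
  fixes n :: nat
  assumes "primepow n" "d dvd n" "d \<noteq> 1"
  shows "primepow d"
proof -
  obtain p k where p: "prime p" "n = p ^ k" using assms(1) unfolding primepow_def by blast
  then obtain i where i: "d = p ^ i" using assms divides_primepow_nat by blast
  then have "0 < i" using assms(3) by (cases i) auto
  then show ?thesis using i p unfolding primepow_def by blast
qed

text \<open>Multiplying by a prime $q$ multiplies the totient by $q$ or by $q-1$, so it stays the same only for
  $q = 2$ and odd argument, and a second factor $2$ then changes it.\<close>

lemma totient_eq_imp_double:
  assumes "m dvd n" "m \<noteq> n" "0 < n" "totient m = totient n"
  shows "n = 2 * m \<and> odd m"
proof -
  obtain k where k: "n = m * k" using assms(1) by blast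
  have "k \<noteq> 1" "0 < k" "0 < m" using k assms by auto
  have step: "q = 2 \<and> odd m" if q: "prime q" "q dvd k" for q
  proof -
    have "totient (m * q) \<le> totient m"
      unfolding assms(4) using q k assms(3) by (intro totient_dvd_mono) auto
    moreover have "totient (m * q) = (if q dvd m then q * totient m else (q - 1) * totient m)"
    proof (cases "q dvd m")
      case True
      then have "gcd m q = q" by (simp add: gcd_nat.absorb2)
      then show ?thesis using True q totient_gcd[of m q] prime_gt_0_nat[of q] by (simp add: totient_gt_0_iff)
    next
      case False
      then have "coprime m q" using q(1) by (metis coprime_commute prime_imp_coprime)
      then show ?thesis using False q by (simp add: totient_mult_coprime totient_prime)
    qed
    ultimately have "\<not> q dvd m" "q - 1 \<le> 1"
      using \<open>0 < m\<close> prime_gt_1_nat[OF q(1)] by (auto split: if_splits)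
    then have "q = 2" using prime_gt_1_nat[OF q(1)] by linarith
    then show ?thesis using \<open>\<not> q dvd m\<close> by simp
  qed
  obtain q where "prime q" "q dvd k" using \<open>k \<noteq> 1\<close> prime_factor_nat by blast
  then have odd: "odd m" and "2 dvd k" using step by auto
  then obtain l where l: "k = 2 * l" by blast
  have "l = 1"
  proof (rule ccontr)
    assume "l \<noteq> 1"
    then obtain r where r: "prime r" "r dvd l" using prime_factor_nat by blast
    then have "r = 2" using step l by simp
    then have "2 * (2 * m) dvd n" using r k l by auto
    then have "totient (2 * (2 * m)) \<le> totient n" using assms(3) by (rule totient_dvd_mono)
    moreover have "totient (2 * (2 * m)) = 2 * totient (2 * m)"
      using totient_double[of "2 * m"] by simp
    moreover have "totient (2 * m) = totient m" using totient_double[of m] odd by simp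
    ultimately show False using assms(4) totient_gt_0_iff[of m] \<open>0 < m\<close> by linarith
  qed
  then show ?thesis using k l odd by simp
qed

section \<open>Neighbourhoods in the power graph\<close>

context finite_group
begin

text \<open>The closed neighbourhood in the power graph. The vertex itself is included in order that adjacent
  twins have equal neighbourhoods.\<close>

definition nbhd :: "'a \<Rightarrow> 'a set" where
  "nbhd x = {y \<in> carrier G. y \<in> generate G {x} \<or> x \<in> generate G {y}}"

definition twins :: "'a \<Rightarrow> 'a set" where
  "twins x = {y \<in> carrier G. nbhd y = nbhd x}"

lemma nbhd_sym: "x \<in> carrier G \<Longrightarrow> y \<in> nbhd x \<Longrightarrow> x \<in> nbhd y"
  by (auto simp: nbhd_def)

lemma nbhd_self: "x \<in> carrier G \<Longrightarrow> x \<in> nbhd x"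
  by (simp add: nbhd_def cyc_self)

lemma nbhd_one: "nbhd \<one> = carrier G"
  by (auto simp: nbhd_def one_in_cyc)

lemma nbhd_eq_if_mutual:
  assumes "x \<in> carrier G" "y \<in> carrier G" "x \<in> generate G {y}" "y \<in> generate G {x}"
  shows "nbhd x = nbhd y"
proof -
  have "generate G {x} = generate G {y}" using assms cyc_mono by blast
  moreover have "x \<in> generate G {z} \<longleftrightarrow> y \<in> generate G {z}" if "z \<in> carrier G" for z
    using assms that cyc_trans by blast
  ultimately show ?thesis by (auto simp: nbhd_def)
qed

lemma mutual_if_ord_eq:
  assumes "x \<in> carrier G" "y \<in> generate G {x}" "ord y = ord x"
  shows "x \<in> generate G {y}"
  using cyc_iff_dvd[OF assms(1) cyc_self assms(2)] assms(3) by simp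

lemma nbhd_eq_if_ord_eq:
  assumes "x \<in> carrier G" "y \<in> generate G {x}" "ord y = ord x"
  shows "nbhd y = nbhd x"
  using nbhd_eq_if_mutual[OF _ assms(1,2)] mutual_if_ord_eq[OF assms] cyc_carrier assms by blast

text \<open>In $\langle x \rangle$ every divisor of the order of $x$ is the order of an element, and all these
  elements are adjacent to $y$. Hence all divisors of $\mathrm{ord}(x)$ are comparable with
  $\mathrm{ord}(y)$.\<close>

lemma primepow_if_nbhd_subset:
  assumes x: "x \<in> carrier G" and y: "y \<in> generate G {x}" "ord y \<noteq> ord x" "y \<noteq> \<one>"
    and sub: "nbhd x \<subseteq> nbhd y"
  shows "primepow (ord x)"
proof (rule primepow_if_divisors_comparable[of "ord y"])
  have yc: "y \<in> carrier G" using cyc_carrier x y by blast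
  show "ord y dvd ord x" using ord_dvd_of_cyc x y by blast
  show "ord y \<noteq> 1" using ord_eq_1[OF yc] y by blast
  show "0 < ord x" using ord_pos x by blast
  fix d assume "d dvd ord x"
  then obtain z where z: "z \<in> generate G {x}" "ord z = d" using ex_cyc_ord x by blast
  have zc: "z \<in> carrier G" using cyc_carrier x z by blast
  then have "z \<in> nbhd y" using z sub by (auto simp: nbhd_def)
  then show "d dvd ord y \<or> ord y dvd d"
    using z(2) ord_dvd_of_cyc yc zc by (auto simp: nbhd_def)
qed fact

text \<open>The subgroups of a cyclic group of prime power order form a chain, so everything below $x$ is
  comparable with $y$. What lies above $x$ lies above $y$ anyway.\<close>

lemma nbhd_antimono_primepow:
  assumes x: "x \<in> carrier G" and p: "primepow (ord x)" and y: "y \<in> generate G {x}"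
  shows "nbhd x \<subseteq> nbhd y"
proof
  fix z assume z: "z \<in> nbhd x"
  then have zc: "z \<in> carrier G" by (simp add: nbhd_def)
  show "z \<in> nbhd y"
  proof (cases "z \<in> generate G {x}")
    case True
    then have "ord y dvd ord z \<or> ord z dvd ord y"
      using divisors_of_primepow_comparable[OF p] ord_dvd_of_cyc x y by blast
    then have "y \<in> generate G {z} \<or> z \<in> generate G {y}"
      using cyc_iff_dvd[OF x y True] cyc_iff_dvd[OF x True y] by simp
    then show ?thesis using zc unfolding nbhd_def by blast
  next
    case False
    then show ?thesis using z zc y cyc_trans by (auto simp: nbhd_def)
  qed
qed

text \<open>Let $\mathrm{ord}(b) = p^s$. If another prime $q$ divided $\mathrm{ord}(z)$, then an element $u$
  of $\langle z \rangle$ of order $q\,\mathrm{ord}(a)$ would be adjacent to $a$, but its order is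
  comparable with $p^s$ only if $p^s$ divides $\mathrm{ord}(a)$.\<close>

lemma primepow_above_mixed_twins:
  assumes b: "b \<in> carrier G" and a: "a \<in> generate G {b}" "ord a \<noteq> ord b" "a \<noteq> \<one>"
    and tw: "nbhd a = nbhd b" and z: "z \<in> carrier G" "a \<in> generate G {z}"
  shows "primepow (ord z)"
proof -
  have ac: "a \<in> carrier G" using cyc_carrier b a by blast
  have "primepow (ord b)" using primepow_if_nbhd_subset b a tw by simp
  then obtain p s where p: "prime p" "ord b = p ^ s" unfolding primepow_def by blast
  obtain i where i: "ord a = p ^ i"
    using p ord_dvd_of_cyc[OF b a(1)] divides_primepow_nat by metis
  have dvd: "ord a dvd ord z" using ord_dvd_of_cyc z by blast
  have "ord a \<noteq> 1" using ord_eq_1[OF ac] a by blast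
  then have "1 < ord z" using dvd ord_pos[OF z(1)] by (cases "ord z = 1") auto
  then show ?thesis
  proof (rule only_prime_divisor_imp_primepow)
    fix q assume q: "prime q" "q dvd ord z"
    show "q = p"
    proof (rule ccontr)
      assume "q \<noteq> p"
      then have "coprime p q" using p(1) q(1) primes_coprime by blast
      then have cop: "coprime (p ^ j) q" for j by simp
      have "ord a * q dvd ord z" using dvd q cop i by (simp add: divides_mult)
      then obtain u where u: "u \<in> generate G {z}" "ord u = ord a * q" using ex_cyc_ord z by blast
      have uc: "u \<in> carrier G" using u z cyc_carrier by blast
      have "a \<in> generate G {u}" using cyc_iff_dvd[OF z(1) z(2) u(1)] u(2) by simp
      then have "u \<in> nbhd b" using uc tw by (auto simp: nbhd_def)
      then have "ord u dvd ord b \<or> ord b dvd ord u"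
        using ord_dvd_of_cyc uc b by (auto simp: nbhd_def)
      then show False
      proof
        assume "ord u dvd ord b"
        then have "q dvd p ^ s" using u p by (metis dvd_mult_right)
        then show False using cop[of s] q by (metis coprime_absorb_right not_prime_unit)
      next
        assume "ord b dvd ord u"
        then have "ord b dvd ord a" using u p cop[of s] by (simp add: coprime_dvd_mult_left_iff)
        then show False using a ord_dvd_of_cyc[OF b a(1)] by (metis dvd_antisym)
      qed
    qed
  qed
qed

lemma gens_subset_twins:
  assumes "x \<in> carrier G"
  shows "{y \<in> generate G {x}. ord y = ord x} \<subseteq> twins x"
  using nbhd_eq_if_ord_eq[OF assms] cyc_carrier[OF assms] by (auto simp: twins_def)

lemma totient_le_card_twins: "x \<in> carrier G \<Longrightarrow> totient (ord x) \<le> card (twins x)"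
  using card_mono[OF _ gens_subset_twins] card_gens fin by (metis (lifting) finite_subset twins_def mem_Collect_eq subsetI)

lemma primepow_above_twin:
  assumes x: "x \<in> carrier G" "nbhd x \<noteq> carrier G" and w: "w \<in> twins x" "ord w \<noteq> ord x"
    and z: "z \<in> carrier G" "x \<in> generate G {z}"
  shows "primepow (ord z)"
proof -
  have wc: "w \<in> carrier G" and tw: "nbhd w = nbhd x" using w by (auto simp: twins_def)
  have "x \<noteq> \<one>" "w \<noteq> \<one>" using x tw nbhd_one by auto
  have "w \<in> nbhd x" using nbhd_self[OF wc] tw by simp
  then consider "w \<in> generate G {x}" | "x \<in> generate G {w}" by (auto simp: nbhd_def)
  then show ?thesis
  proof cases
    case 1
    then show ?thesis
      using primepow_above_mixed_twins[OF x(1) 1 w(2) \<open>w \<noteq> \<one>\<close> tw z(1)] z cyc_trans by blast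
  next
    case 2
    then show ?thesis
      using primepow_above_mixed_twins[OF wc 2 _ \<open>x \<noteq> \<one>\<close> _ z] w tw by metis
  qed
qed

text \<open>By \<open>primepow_above_twin\<close> the twins of such an $x$ all have the same order, hence
  generate the same subgroup.\<close>

lemma card_twins_if_not_primepow_above:
  assumes x: "x \<in> carrier G" "nbhd x \<noteq> carrier G"
    and z: "z \<in> carrier G" "x \<in> generate G {z}" "\<not> primepow (ord z)"
  shows "card (twins x) = totient (ord x)"
proof -
  have "w \<in> generate G {x} \<and> ord w = ord x" if w: "w \<in> twins x" for w
  proof -
    have o: "ord w = ord x" using primepow_above_twin[OF x w _ z(1,2)] z(3) by blast
    have wc: "w \<in> carrier G" and "w \<in> nbhd x"
      using w nbhd_self by (auto simp: twins_def)
    then show ?thesis using o mutual_if_ord_eq[OF wc, of x] by (auto simp: nbhd_def)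
  qed
  then have "twins x = {y \<in> generate G {x}. ord y = ord x}"
    using gens_subset_twins[OF x(1)] by blast
  then show ?thesis using card_gens x by simp
qed

text \<open>Let $\mathrm{ord}(x) = p^a$. All twins of $y$ lie strictly below $x$, hence among the
  $p^{a-1} - 1$ nontrivial elements of $\langle x^p \rangle$. The generators of
  $\langle x \rangle$ are at least $p^{a-1}$ twins of $x$.\<close>

lemma card_twins_less_primepow:
  assumes x: "x \<in> carrier G" and p: "primepow (ord x)" and y: "y \<in> generate G {x}"
    and nt: "nbhd y \<noteq> nbhd x" and nd: "nbhd y \<noteq> carrier G"
  shows "card (twins y) < card (twins x)"
proof -
  obtain p a where pa: "prime p" "0 < a" "ord x = p ^ a" using p unfolding primepow_def by blast
  have yc: "y \<in> carrier G" using cyc_carrier x y by blast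
  have y1: "y \<noteq> \<one>" using nd nbhd_one by auto
  have xpc: "x [^] p \<in> carrier G" using x by simp
  have "p dvd ord x" "p \<noteq> 0" using pa by auto
  have "ord (x [^] p) = ord x div p" by (rule ord_pow) fact+
  then have oxp: "ord (x [^] p) = p ^ (a - 1)"
    using pa \<open>p \<noteq> 0\<close> by (cases a) auto
  have "twins y \<subseteq> generate G {x [^] p} - {\<one>}"
  proof
    fix w assume w: "w \<in> twins y"
    then have wc: "w \<in> carrier G" and tw: "nbhd w = nbhd y" by (auto simp: twins_def)
    \<comment> \<open>otherwise $y$, $x$, $w$ is a chain with twins at its ends, and $x$ would be a twin as well\<close>
    have wx: "\<not> x \<in> generate G {w}"
    proof
      assume xw: "x \<in> generate G {w}"
      have yw: "y \<in> generate G {w}" using cyc_trans wc xw y by blast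
      have "ord y \<noteq> ord w"
      proof
        assume "ord y = ord w"
        then have "ord y = ord x"
          using ord_dvd_of_cyc[OF wc xw] ord_dvd_of_cyc[OF x y] by (metis dvd_antisym)
        then show False using nbhd_eq_if_ord_eq x y nt by blast
      qed
      then have "primepow (ord w)" using primepow_if_nbhd_subset[OF wc yw _ y1] tw by simp
      then have "nbhd w \<subseteq> nbhd x" using nbhd_antimono_primepow wc xw by blast
      then show False using nbhd_antimono_primepow[OF x p y] tw nt by blast
    qed
    have "x \<in> nbhd w" using tw x y by (simp add: nbhd_def)
    then have wx2: "w \<in> generate G {x}" using wx by (simp add: nbhd_def)
    have "ord w \<noteq> ord x" using mutual_if_ord_eq x wx wx2 by blast
    obtain i where i: "ord w = p ^ i" "i \<le> a"
      using ord_dvd_of_cyc[OF x wx2] pa divides_primepow_nat by metis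
    then have "i \<le> a - 1" using \<open>ord w \<noteq> ord x\<close> pa by (metis le_eq_less_or_eq less_Suc_eq_le Suc_pred')
    then have "ord w dvd ord (x [^] p)" using i oxp by (simp add: le_imp_power_dvd)
    then have "w \<in> generate G {x [^] p}"
      using cyc_iff_dvd[OF x wx2] pow_in_cyc[OF x] by blast
    moreover have "w \<noteq> \<one>" using nd tw nbhd_one by auto
    ultimately show "w \<in> generate G {x [^] p} - {\<one>}" by blast
  qed
  then have "card (twins y) \<le> card (generate G {x [^] p} - {\<one>})"
    using finite_cyc[OF xpc] by (intro card_mono) auto
  also have "\<dots> < card (generate G {x [^] p})"
    using finite_cyc[OF xpc] one_in_cyc by (intro psubset_card_mono) auto
  also have "\<dots> = p ^ (a - 1)" using card_cyc[OF xpc] oxp by simp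
  also have "\<dots> \<le> totient (ord x)"
    using totient_prime_power[of p a] pa prime_gt_1_nat[of p] by simp
  also have "\<dots> \<le> card (twins x)" using totient_le_card_twins x by blast
  finally show ?thesis .
qed

text \<open>The number of twins is monotone along the direction of edges between elements that are not twins.
  If $\mathrm{ord}(x)$ is a prime power, the inequality is strict; otherwise the two numbers are
  the totients of the orders, which agree only if the order doubles from an odd number.\<close>

lemma card_twins_mono:
  assumes x: "x \<in> carrier G" and y: "y \<in> generate G {x}"
    and nt: "nbhd y \<noteq> nbhd x" and nd: "nbhd y \<noteq> carrier G" "nbhd x \<noteq> carrier G"
  shows "card (twins y) \<le> card (twins x)"
    and "card (twins y) = card (twins x) \<Longrightarrow> ord x = 2 * ord y \<and> odd (ord y)"
proof -
  have yc: "y \<in> carrier G" using cyc_carrier x y by blast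
  have tot: "card (twins y) = totient (ord y) \<and> card (twins x) = totient (ord x)" if "\<not> primepow (ord x)"
    using card_twins_if_not_primepow_above x yc y nd that cyc_self by metis
  have dvd: "ord y dvd ord x" using ord_dvd_of_cyc x y by blast
  have "ord y \<noteq> ord x" using nt nbhd_eq_if_ord_eq x y by blast
  show "card (twins y) \<le> card (twins x)"
    using tot totient_dvd_mono[OF dvd ord_pos[OF x]] card_twins_less_primepow[OF x _ y nt nd(1)]
    by (cases "primepow (ord x)") auto
  show "ord x = 2 * ord y \<and> odd (ord y)" if "card (twins y) = card (twins x)"
    using that tot totient_eq_imp_double[OF dvd \<open>ord y \<noteq> ord x\<close> ord_pos[OF x]]
      card_twins_less_primepow[OF x _ y nt nd(1)]
    by (cases "primepow (ord x)") auto
qed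

text \<open>Twins are adjacent, so they form a chain of cyclic subgroups, and a twin of maximal order is at the
  top.\<close>

lemma ex_maximal_twin:
  assumes x: "x \<in> carrier G"
  shows "\<exists>t\<in>twins x. twins x \<subseteq> generate G {t}"
proof -
  have fin_tw: "finite (ord ` twins x)" using fin by (auto simp: twins_def)
  have "x \<in> twins x" using x by (simp add: twins_def)
  then have "Max (ord ` twins x) \<in> ord ` twins x" using Max_in[OF fin_tw] by blast
  then obtain t where t: "t \<in> twins x" "ord t = Max (ord ` twins x)" by (metis imageE)
  then have tc: "t \<in> carrier G" by (simp add: twins_def)
  have "w \<in> generate G {t}" if w: "w \<in> twins x" for w
  proof -
    have wc: "w \<in> carrier G" using w by (simp add: twins_def)
    have "ord w \<le> ord t" using t(2) fin_tw w by simp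
    have "w \<in> nbhd t" using w t nbhd_self[OF wc] by (simp add: twins_def)
    then show ?thesis
    proof (cases "w \<in> generate G {t}")
      case False
      then have tw: "t \<in> generate G {w}" using \<open>w \<in> nbhd t\<close> by (simp add: nbhd_def)
      then have "ord t dvd ord w" using ord_dvd_of_cyc wc by blast
      then have "ord t = ord w" using \<open>ord w \<le> ord t\<close> ord_pos[OF wc] dvd_imp_le le_antisym by blast
      then show ?thesis using mutual_if_ord_eq[OF wc tw] by blast
    qed
  qed
  then show ?thesis using t by blast
qed

text \<open>The set is the cyclic subgroup generated by a twin $t$ of maximal order. An element of
  $\langle t \rangle$ outside $\langle x \rangle$ lies between $x$ and $t$ in a chain of prime
  power order, and is therefore a twin itself.\<close>

lemma twins_Un_cyc_cyclic:
  assumes dom: "\<And>z. z \<in> carrier G \<Longrightarrow> nbhd z = carrier G \<Longrightarrow> z = \<one>" and x: "x \<in> carrier G"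
  shows "twins x \<union> generate G {x} \<in> cyclic_subgroups G"
proof -
  obtain t where t: "t \<in> twins x" "twins x \<subseteq> generate G {t}" using ex_maximal_twin x by blast
  have tc: "t \<in> carrier G" and tw: "nbhd t = nbhd x" using t by (auto simp: twins_def)
  have xt: "x \<in> generate G {t}" using t x by (auto simp: twins_def)
  have "y \<in> twins x \<union> generate G {x}" if y: "y \<in> generate G {t}" for y
  proof (cases "y \<in> generate G {x} \<or> x = \<one>")
    case True
    then show ?thesis using dom[OF tc] tw nbhd_one y by (auto simp: one_in_cyc)
  next
    case False
    have yc: "y \<in> carrier G" using y tc cyc_carrier by blast
    then have "y \<in> nbhd x" using y tw by (auto simp: nbhd_def)
    then have xy: "x \<in> generate G {y}" using False by (simp add: nbhd_def)
    show ?thesis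
    proof (cases "ord x = ord t")
      case True
      then have "t \<in> generate G {x}" using mutual_if_ord_eq tc xt by blast
      then show ?thesis using cyc_trans x y by blast
    next
      case neq: False
      have "primepow (ord t)"
        using primepow_if_nbhd_subset[OF tc xt neq] False tw by simp
      then have "nbhd t \<subseteq> nbhd y" using nbhd_antimono_primepow tc y by blast
      moreover have "primepow (ord y)"
        using \<open>primepow (ord t)\<close> ord_dvd_of_cyc[OF tc y] ord_eq_1[OF yc] False one_in_cyc
        by (metis primepow_dvd)
      then have "nbhd y \<subseteq> nbhd x" using nbhd_antimono_primepow yc xy by blast
      ultimately show ?thesis using tw yc by (auto simp: twins_def)
    qed
  qed
  then have "twins x \<union> generate G {x} = generate G {t}" using t(2) cyc_mono[OF tc xt] by blast
  then show ?thesis using cyc_in_cyclic_subgroups tc by simp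
qed

text \<open>If all orders are prime powers, neighbourhoods shrink when passing upwards, so the set consists of
  all elements below a twin of $x$ of maximal order.\<close>

lemma nbhd_upset_cyclic:
  assumes pp: "\<And>z. z \<in> carrier G \<Longrightarrow> z \<noteq> \<one> \<Longrightarrow> primepow (ord z)" and x: "x \<in> carrier G"
  shows "{y \<in> carrier G. nbhd x \<subseteq> nbhd y} \<in> cyclic_subgroups G"
proof -
  have anti: "nbhd z \<subseteq> nbhd y" if "z \<in> carrier G" "y \<in> generate G {z}" for y z
  proof (cases "z = \<one>")
    case True
    then have "y = \<one>" using that generate_one by auto
    then show ?thesis using True by simp
  next
    case False
    then show ?thesis using nbhd_antimono_primepow pp that by blast
  qed
  obtain t where t: "t \<in> twins x" "twins x \<subseteq> generate G {t}" using ex_maximal_twin x by blast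
  have tc: "t \<in> carrier G" and tw: "nbhd t = nbhd x" using t by (auto simp: twins_def)
  have "{y \<in> carrier G. nbhd x \<subseteq> nbhd y} = generate G {t}"
  proof (intro subset_antisym subsetI)
    fix y assume "y \<in> {y \<in> carrier G. nbhd x \<subseteq> nbhd y}"
    then have y: "y \<in> carrier G" "nbhd t \<subseteq> nbhd y" using tw by auto
    then have "t \<in> nbhd y" using nbhd_self tc by blast
    then consider "y \<in> generate G {t}" | "t \<in> generate G {y}" by (auto simp: nbhd_def)
    then show "y \<in> generate G {t}"
    proof cases
      case 2
      then have "nbhd y = nbhd x" using anti y tw by blast
      then show ?thesis using t y by (auto simp: twins_def)
    qed
  next
    fix y assume "y \<in> generate G {t}"
    then show "y \<in> {y \<in> carrier G. nbhd x \<subseteq> nbhd y}" using anti[OF tc] cyc_carrier tc tw by auto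
  qed
  then show ?thesis using cyc_in_cyclic_subgroups tc by simp
qed

text \<open>An element strictly above the dominating vertex $x$ would have prime power order by
  \<open>primepow_if_nbhd_subset\<close>, since $x$ is adjacent to everything. Then $x$ has
  prime power order too, and $w$ can be neither below nor above it.\<close>

lemma cyclic_if_dominating:
  assumes x: "x \<in> carrier G" "x \<noteq> \<one>" "nbhd x = carrier G"
    and w: "w \<in> carrier G" "w \<noteq> \<one>" "\<not> primepow (ord w)"
  shows "carrier G = generate G {x}"
proof -
  have pp: "primepow (ord z)" if "z \<in> carrier G" "x \<in> generate G {z}" "ord x \<noteq> ord z" for z
    using primepow_if_nbhd_subset[OF that(1,2,3) x(2)] x(3) by (auto simp: nbhd_def)
  have "z \<in> generate G {x}" if z: "z \<in> carrier G" for z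
  proof (rule ccontr)
    assume nz: "z \<notin> generate G {x}"
    then have xz: "x \<in> generate G {z}" using z x by (auto simp: nbhd_def)
    have "ord x \<noteq> ord z" using mutual_if_ord_eq[OF z xz] nz by blast
    then have "primepow (ord z)" using pp z xz by blast
    then have px: "primepow (ord x)"
      using ord_dvd_of_cyc[OF z xz] ord_eq_1[OF x(1)] x(2) by (metis primepow_dvd)
    have "w \<in> nbhd x" using w x by simp
    then consider "w \<in> generate G {x}" | "x \<in> generate G {w}" by (auto simp: nbhd_def)
    then show False
    proof cases
      case 1
      then show False using px w ord_dvd_of_cyc[OF x(1) 1] ord_eq_1[OF w(1)] by (metis primepow_dvd)
    next
      case 2
      then show False using pp[OF w(1) 2] px w by metis
    qed
  qed
  then show ?thesis using cyc_subset_carrier x by blast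
qed

lemma cauchy:
  assumes "prime p" "p dvd order G"
  shows "\<exists>x\<in>carrier G. ord x = p"
proof -
  obtain m where "order G = p ^ 1 * m" using assms by auto
  then have "sylow G p 1 m"
    using assms fin by (simp add: sylow_eq sylow_axioms_def is_group)
  then obtain K where K: "subgroup K G" "card K = p" using sylow.sylow_thm by fastforce
  then have "1 < card K" using assms prime_gt_1_nat by blast
  then have "\<not> K \<subseteq> {\<one>}" using card_mono[of "{\<one>}" K] by auto
  then obtain x where x: "x \<in> K" "x \<noteq> \<one>" by blast
  have xc: "x \<in> carrier G" by (rule subgroup.mem_carrier[OF K(1) x(1)])
  have "x [^]\<^bsub>G\<lparr>carrier := K\<rparr>\<^esub> order (G\<lparr>carrier := K\<rparr>) = \<one>"
    using group.pow_order_eq_1[OF subgroup_imp_group[OF K(1)], of x] x by simp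
  then have "x [^] p = \<one>" using K by (simp add: order_def nat_pow_consistent[symmetric])
  then have "ord x dvd p" using pow_eq_id xc by blast
  then show ?thesis using assms x xc ord_eq_1 by (metis prime_nat_iff)
qed

end

section \<open>Isomorphisms of power graphs\<close>

locale power_graph_iso = G: finite_group G + H: finite_group H
  for G :: "('a, 'm) monoid_scheme" and H :: "('b, 'n) monoid_scheme" +
  fixes f :: "'a \<Rightarrow> 'b"
  assumes bij: "bij_betw f (carrier G) (carrier H)"
    and nbhd_iff: "x \<in> carrier G \<Longrightarrow> y \<in> carrier G \<Longrightarrow> f y \<in> H.nbhd (f x) \<longleftrightarrow> y \<in> G.nbhd x"
begin

lemma inj: "inj_on f (carrier G)" and surj: "f ` carrier G = carrier H"
  using bij by (auto simp: bij_betw_def)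

lemma f_closed: "x \<in> carrier G \<Longrightarrow> f x \<in> carrier H"
  using surj by blast

lemma nbhd_image: "x \<in> carrier G \<Longrightarrow> H.nbhd (f x) = f ` G.nbhd x"
proof (intro subset_antisym subsetI)
  fix z assume x: "x \<in> carrier G" and z: "z \<in> H.nbhd (f x)"
  then obtain y where "y \<in> carrier G" "z = f y" using surj by (auto simp: H.nbhd_def)
  then show "z \<in> f ` G.nbhd x" using nbhd_iff x z by blast
next
  fix z assume x: "x \<in> carrier G" and z: "z \<in> f ` G.nbhd x"
  then obtain y where "y \<in> G.nbhd x" "z = f y" by blast
  moreover have "y \<in> carrier G" using calculation by (simp add: G.nbhd_def)
  ultimately show "z \<in> H.nbhd (f x)" using nbhd_iff x by blast
qed

lemma nbhd_subset_iff:
  assumes "x \<in> carrier G" "y \<in> carrier G"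
  shows "H.nbhd (f x) \<subseteq> H.nbhd (f y) \<longleftrightarrow> G.nbhd x \<subseteq> G.nbhd y"
proof -
  have "G.nbhd x \<subseteq> carrier G" "G.nbhd y \<subseteq> carrier G" by (auto simp: G.nbhd_def)
  then show ?thesis
    unfolding nbhd_image[OF assms(1)] nbhd_image[OF assms(2)]
    using inj_on_image_mem_iff[OF inj] by blast
qed

lemma nbhd_eq_iff:
  "x \<in> carrier G \<Longrightarrow> y \<in> carrier G \<Longrightarrow> H.nbhd (f x) = H.nbhd (f y) \<longleftrightarrow> G.nbhd x = G.nbhd y"
  using nbhd_subset_iff by (simp add: set_eq_subset)

lemma twins_image: "x \<in> carrier G \<Longrightarrow> H.twins (f x) = f ` G.twins x"
  unfolding H.twins_def G.twins_def surj[symmetric] using nbhd_eq_iff by blast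

text \<open>A twin class may contain elements of different orders, and $f$ may permute them. The size of the
  class is the invariant that takes the place of the order.\<close>

lemma card_twins: "x \<in> carrier G \<Longrightarrow> card (H.twins (f x)) = card (G.twins x)"
proof -
  assume x: "x \<in> carrier G"
  have "inj_on f (G.twins x)" by (rule inj_on_subset[OF inj]) (auto simp: G.twins_def)
  then show ?thesis using twins_image[OF x] by (simp add: card_image)
qed

lemma dominating_iff: "x \<in> carrier G \<Longrightarrow> H.nbhd (f x) = carrier H \<longleftrightarrow> G.nbhd x = carrier G"
proof -
  assume x: "x \<in> carrier G"
  have "G.nbhd x \<subseteq> carrier G" by (auto simp: G.nbhd_def)
  then show ?thesis
    unfolding nbhd_image[OF x] surj[symmetric] by (intro inj_on_image_eq_iff[OF inj]) auto
qed

lemma same_order: "order G = order H"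
  using bij_betw_same_card[OF bij] by (simp add: order_def)

text \<open>Suppose that $f$ reverses the edge. Monotonicity of the number of twins in both groups forces
  equality, hence $\mathrm{ord}(x) = 2\,\mathrm{ord}(y)$ with $\mathrm{ord}(y)$ odd. Let $z$ be the
  involution in $\langle x \rangle$. It is not adjacent to $y$, so $f(z)$ is adjacent to $f(x)$ but
  not to $f(y)$, which places $f(x)$ below $f(z)$. Hence $z$ has as many twins as $x$, and the same
  monotonicity now demands that $z$ have odd order.\<close>

lemma preserves_direction:
  assumes dom: "\<And>z. z \<in> carrier G \<Longrightarrow> G.nbhd z = carrier G \<Longrightarrow> z = \<one>\<^bsub>G\<^esub>"
    and x: "x \<in> carrier G" and y: "y \<in> generate G {x}" and nt: "G.nbhd y \<noteq> G.nbhd x"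
  shows "f y \<in> generate H {f x}"
proof (rule ccontr)
  assume contra: "f y \<notin> generate H {f x}"
  have yc: "y \<in> carrier G" using G.cyc_carrier x y by blast
  have "f y \<in> H.nbhd (f x)" using nbhd_iff x y yc by (simp add: G.nbhd_def)
  then have rev: "f x \<in> generate H {f y}" using contra by (simp add: H.nbhd_def)
  have domH: "z = \<one>\<^bsub>G\<^esub>" if "z \<in> carrier G" "H.nbhd (f z) = carrier H" for z
    using dom dominating_iff that by blast
  \<comment> \<open>the identity is the unique dominating vertex in both groups, so $f$ fixes it\<close>
  have f1: "f \<one>\<^bsub>G\<^esub> = \<one>\<^bsub>H\<^esub>"
  proof -
    obtain e where e: "e \<in> carrier G" "f e = \<one>\<^bsub>H\<^esub>" using surj H.one_closed by (metis imageE)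
    then show ?thesis using domH[of e] H.nbhd_one by simp
  qed
  have "y \<noteq> \<one>\<^bsub>G\<^esub>" using contra f1 H.one_in_cyc by auto
  then have ndy: "G.nbhd y \<noteq> carrier G" using dom yc by blast
  have "x \<noteq> \<one>\<^bsub>G\<^esub>" using y \<open>y \<noteq> \<one>\<^bsub>G\<^esub>\<close> G.generate_one by auto
  then have ndx: "G.nbhd x \<noteq> carrier G" using dom x by blast
  have ntH: "H.nbhd (f x) \<noteq> H.nbhd (f y)" using nt nbhd_eq_iff x yc by metis
  have ndH: "H.nbhd (f x) \<noteq> carrier H" "H.nbhd (f y) \<noteq> carrier H"
    using ndx ndy dominating_iff x yc by auto
  note mono = G.card_twins_mono[OF x y nt ndy ndx]
  note monoH = H.card_twins_mono[OF f_closed[OF yc] rev ntH ndH]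
  have eq: "card (G.twins y) = card (G.twins x)"
    using mono(1) monoH(1) card_twins[OF x] card_twins[OF yc] by simp
  then have ox: "G.ord x = 2 * G.ord y" "odd (G.ord y)" using mono(2) by auto
  obtain z where z: "z \<in> generate G {x}" "G.ord z = 2"
    using G.ex_cyc_ord[OF x, of 2] ox(1) by auto
  have zc: "z \<in> carrier G" using G.cyc_carrier x z by blast
  have "z \<notin> G.nbhd y"
  proof
    assume "z \<in> G.nbhd y"
    then consider "z \<in> generate G {y}" | "y \<in> generate G {z}" by (auto simp: G.nbhd_def)
    then show False
    proof cases
      case 1
      then have "2 dvd G.ord y" using G.ord_dvd_of_cyc[OF yc 1] z(2) by simp
      then show False using ox(2) by simp
    next
      case 2
      then have "G.ord y dvd 2" using G.ord_dvd_of_cyc[OF zc 2] z(2) by simp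
      then have "G.ord y = 1" using ox(2) by (metis prime_nat_iff two_is_prime_nat dvd_refl)
      then show False using G.ord_eq_1[OF yc] \<open>y \<noteq> \<one>\<^bsub>G\<^esub>\<close> by blast
    qed
  qed
  have zx: "z \<in> G.nbhd x" using z zc by (simp add: G.nbhd_def)
  have yx: "y \<in> G.nbhd x" using y yc by (simp add: G.nbhd_def)
  have "y \<notin> G.nbhd z" using \<open>z \<notin> G.nbhd y\<close> G.nbhd_sym zc by blast
  then have ntz: "G.nbhd z \<noteq> G.nbhd x" and ndz: "G.nbhd z \<noteq> carrier G" using yx yc by auto
  have "f z \<notin> generate H {f x}"
  proof
    assume "f z \<in> generate H {f x}"
    then have "f z \<in> generate H {f y}" using H.cyc_trans f_closed yc rev by blast
    then have "f z \<in> H.nbhd (f y)" using f_closed zc by (simp add: H.nbhd_def)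
    then show False using nbhd_iff[OF yc zc] \<open>z \<notin> G.nbhd y\<close> by simp
  qed
  then have fxz: "f x \<in> generate H {f z}"
    using nbhd_iff[OF x zc] zx by (auto simp: H.nbhd_def)
  have "card (H.twins (f x)) \<le> card (H.twins (f z))"
    using H.card_twins_mono(1)[OF f_closed[OF zc] fxz] nbhd_eq_iff[OF x zc] ntz
      dominating_iff[OF x] dominating_iff[OF zc] ndx ndz by metis
  then have "card (G.twins z) = card (G.twins x)"
    using G.card_twins_mono(1)[OF x z(1) ntz ndz ndx] card_twins x zc by simp
  then show False using G.card_twins_mono(2)[OF x z(1) ntz ndz ndx] z(2) by simp
qed

text \<open>The union absorbs the twins, within which $f$ says nothing about directions.\<close>

lemma image_twins_Un_cyc:
  assumes dom: "\<And>z. z \<in> carrier G \<Longrightarrow> G.nbhd z = carrier G \<Longrightarrow> z = \<one>\<^bsub>G\<^esub>"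
    and x: "x \<in> carrier G"
  shows "f ` (G.twins x \<union> generate G {x}) = H.twins (f x) \<union> generate H {f x}"
proof -
  have "f w \<in> H.twins (f x) \<union> generate H {f x} \<longleftrightarrow> w \<in> G.twins x \<union> generate G {x}"
    if w: "w \<in> carrier G" for w
  proof (cases "G.nbhd w = G.nbhd x")
    case True
    then show ?thesis using w f_closed nbhd_eq_iff x by (simp add: G.twins_def H.twins_def)
  next
    case False
    have "w \<in> generate G {x}" if fw: "f w \<in> generate H {f x}"
    proof (rule ccontr)
      assume n: "w \<notin> generate G {x}"
      have "f w \<in> H.nbhd (f x)" using fw f_closed w by (simp add: H.nbhd_def)
      then have "x \<in> generate G {w}" using nbhd_iff x w n by (auto simp: G.nbhd_def)
      then have "f x \<in> generate H {f w}" using preserves_direction[OF dom w] False by metis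
      then have "H.nbhd (f w) = H.nbhd (f x)"
        using H.nbhd_eq_if_mutual f_closed fw w x by blast
      then show False using False nbhd_eq_iff w x by blast
    qed
    moreover have "f w \<in> generate H {f x}" if "w \<in> generate G {x}"
      using preserves_direction[OF dom x that False] .
    moreover have "w \<notin> G.twins x" "f w \<notin> H.twins (f x)"
      using False nbhd_eq_iff w x by (auto simp: G.twins_def H.twins_def)
    ultimately show ?thesis by blast
  qed
  moreover have "G.twins x \<union> generate G {x} \<subseteq> carrier G"
    using G.cyc_subset_carrier x by (auto simp: G.twins_def)
  moreover have "H.twins (f x) \<union> generate H {f x} \<subseteq> f ` carrier G"
    using H.cyc_subset_carrier f_closed x unfolding surj by (auto simp: H.twins_def)
  ultimately show ?thesis by blast
qed

lemma sim2_if_only_one_dominates: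
  assumes dom: "\<And>z. z \<in> carrier G \<Longrightarrow> G.nbhd z = carrier G \<Longrightarrow> z = \<one>\<^bsub>G\<^esub>"
  shows "sim2 G H"
proof -
  have domH: "z = \<one>\<^bsub>H\<^esub>" if z: "z \<in> carrier H" "H.nbhd z = carrier H" for z
  proof -
    obtain x where x: "x \<in> carrier G" "z = f x" using surj z by (metis imageE)
    obtain e where e: "e \<in> carrier G" "\<one>\<^bsub>H\<^esub> = f e" using surj H.one_closed by (metis imageE)
    have "x = \<one>\<^bsub>G\<^esub>" "e = \<one>\<^bsub>G\<^esub>"
      using dom dominating_iff x e z H.nbhd_one by metis+
    then show ?thesis using x e by simp
  qed
  show ?thesis
  proof (rule sim2_if_bij_on_cyclic_cover[OF G.finite_group_axioms H.finite_group_axioms bij,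
        where I = "carrier G" and A = "\<lambda>x. G.twins x \<union> generate G {x}"])
    fix x assume x: "x \<in> carrier G"
    show "G.twins x \<union> generate G {x} \<in> cyclic_subgroups G"
      by (rule G.twins_Un_cyc_cyclic[OF dom x])
    have "f ` (G.twins x \<union> generate G {x}) = H.twins (f x) \<union> generate H {f x}"
      by (rule image_twins_Un_cyc[OF dom x])
    also have "\<dots> \<in> cyclic_subgroups H"
      by (rule H.twins_Un_cyc_cyclic[OF domH f_closed[OF x]])
    finally show "f ` (G.twins x \<union> generate G {x}) \<in> cyclic_subgroups H" .
  next
    show "(\<Union>x\<in>carrier G. G.twins x \<union> generate G {x}) = carrier G"
    proof (intro subset_antisym subsetI)
      fix z assume "z \<in> carrier G"
      then show "z \<in> (\<Union>x\<in>carrier G. G.twins x \<union> generate G {x})"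
        by (intro UN_I[of z]) (simp_all add: G.cyc_self)
    next
      fix z assume "z \<in> (\<Union>x\<in>carrier G. G.twins x \<union> generate G {x})"
      then show "z \<in> carrier G" using G.cyc_carrier unfolding G.twins_def by blast
    qed
  qed
qed

lemma sim2_if_all_primepow:
  assumes "\<And>z. z \<in> carrier G \<Longrightarrow> z \<noteq> \<one>\<^bsub>G\<^esub> \<Longrightarrow> primepow (G.ord z)"
    and "\<And>z. z \<in> carrier H \<Longrightarrow> z \<noteq> \<one>\<^bsub>H\<^esub> \<Longrightarrow> primepow (H.ord z)"
  shows "sim2 G H"
proof (rule sim2_if_bij_on_cyclic_cover[OF G.finite_group_axioms H.finite_group_axioms bij,
      where I = "carrier G" and A = "\<lambda>x. {y \<in> carrier G. G.nbhd x \<subseteq> G.nbhd y}"])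
  fix x assume x: "x \<in> carrier G"
  show "{y \<in> carrier G. G.nbhd x \<subseteq> G.nbhd y} \<in> cyclic_subgroups G"
    using G.nbhd_upset_cyclic assms(1) x by blast
  have "f ` {y \<in> carrier G. G.nbhd x \<subseteq> G.nbhd y} = {z \<in> carrier H. H.nbhd (f x) \<subseteq> H.nbhd z}"
    unfolding surj[symmetric] using nbhd_subset_iff[OF x] by blast
  then show "f ` {y \<in> carrier G. G.nbhd x \<subseteq> G.nbhd y} \<in> cyclic_subgroups H"
    using H.nbhd_upset_cyclic assms(2) f_closed x by metis
qed auto

lemma sim2_if_both_cyclic:
  assumes "carrier G = generate G {x}" "x \<in> carrier G" "carrier H = generate H {y}" "y \<in> carrier H"
  shows "sim2 G H"
proof (rule sim2_if_bij_on_cyclic_cover[OF G.finite_group_axioms H.finite_group_axioms bij,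
      where I = "{()}" and A = "\<lambda>_. carrier G"])
  show "carrier G \<in> cyclic_subgroups G" using G.cyc_in_cyclic_subgroups assms by metis
  show "f ` carrier G \<in> cyclic_subgroups H" using H.cyc_in_cyclic_subgroups assms surj by metis
qed auto

end

text \<open>By Cauchy's theorem each prime divisor $q$ of the common group order is the order of some $u$ in
  $G$, which is adjacent to the dominating vertex $x$. As $\mathrm{ord}(x)$ is a power of some prime
  $p$, this leaves only $q = p$.\<close>

lemma (in finite_group) all_primepow_transfer:
  assumes H: "finite_group H" and ord: "order H = order G"
    and x: "x \<in> carrier G" "x \<noteq> \<one>" "nbhd x = carrier G"
    and pp: "\<And>z. z \<in> carrier G \<Longrightarrow> z \<noteq> \<one> \<Longrightarrow> primepow (ord z)"
    and w: "w \<in> carrier H" "w \<noteq> \<one>\<^bsub>H\<^esub>"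
  shows "primepow (group.ord H w)"
proof -
  interpret H: finite_group H by fact
  obtain p k where p: "prime p" "0 < k" "ord x = p ^ k"
    using pp[OF x(1,2)] unfolding primepow_def by blast
  have "H.ord w \<noteq> 1" using H.ord_eq_1 w by blast
  then have "1 < H.ord w" using H.ord_pos[OF w(1)] by linarith
  then show ?thesis
  proof (rule only_prime_divisor_imp_primepow)
    fix q assume q: "prime q" "q dvd H.ord w"
    then have "q dvd order G" using H.ord_dvd_group_order[OF w(1)] ord by (metis dvd_trans)
    then obtain u where u: "u \<in> carrier G" "ord u = q" using cauchy q by blast
    then have "u \<in> nbhd x" using x by simp
    then have "ord u dvd ord x \<or> ord x dvd ord u"
      using ord_dvd_of_cyc u(1) x(1) unfolding nbhd_def by blast
    then show "q = p"
    proof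
      assume "ord u dvd ord x"
      then show ?thesis using u p q by (metis prime_dvd_power primes_dvd_imp_eq)
    next
      assume "ord x dvd ord u"
      then have "p dvd q" using u p by (metis dvd_power dvd_trans)
      then show ?thesis using p q by (metis primes_dvd_imp_eq)
    qed
  qed
qed

text \<open>A second dominating vertex exists in both groups or in neither. If it exists, then
  all nontrivial elements have prime power order in both groups or in neither, and in the latter case
  both groups are cyclic.\<close>

lemma (in power_graph_iso) sim2_of_power_graph_iso: "sim2 G H"
proof (cases "\<forall>z\<in>carrier G. G.nbhd z = carrier G \<longrightarrow> z = \<one>\<^bsub>G\<^esub>")
  case True
  then show ?thesis using sim2_if_only_one_dominates by blast
next
  case False
  then obtain x where x: "x \<in> carrier G" "x \<noteq> \<one>\<^bsub>G\<^esub>" "G.nbhd x = carrier G" by blast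
  obtain y where y: "y \<in> carrier H" "y \<noteq> \<one>\<^bsub>H\<^esub>" "H.nbhd y = carrier H"
  proof -
    have "f x \<noteq> f \<one>\<^bsub>G\<^esub>" using inj x by (metis G.one_closed inj_onD)
    then have "f x \<noteq> \<one>\<^bsub>H\<^esub> \<or> f \<one>\<^bsub>G\<^esub> \<noteq> \<one>\<^bsub>H\<^esub>" by metis
    then show ?thesis
      using that f_closed x dominating_iff G.nbhd_one G.one_closed by metis
  qed
  let ?P = "\<forall>z\<in>carrier G. z \<noteq> \<one>\<^bsub>G\<^esub> \<longrightarrow> primepow (G.ord z)"
  let ?Q = "\<forall>z\<in>carrier H. z \<noteq> \<one>\<^bsub>H\<^esub> \<longrightarrow> primepow (H.ord z)"
  have PQ: ?Q if ?P
    using that G.all_primepow_transfer[OF H.finite_group_axioms same_order[symmetric] x] by blast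
  have QP: ?P if ?Q
    using that H.all_primepow_transfer[OF G.finite_group_axioms same_order y] by blast
  show ?thesis
  proof (cases ?P)
    case True
    then show ?thesis using PQ sim2_if_all_primepow by blast
  next
    case False
    then obtain u v where "u \<in> carrier G" "u \<noteq> \<one>\<^bsub>G\<^esub>" "\<not> primepow (G.ord u)"
      "v \<in> carrier H" "v \<noteq> \<one>\<^bsub>H\<^esub>" "\<not> primepow (H.ord v)" using QP by blast
    then show ?thesis
      using sim2_if_both_cyclic G.cyclic_if_dominating[OF x] H.cyclic_if_dominating[OF y] x y by metis
  qed
qed

lemma (in finite_group) power_graph_arc_iff:
  assumes "g \<in> carrier G" "h \<in> carrier G"
  shows "(g, h) \<in> parcs (power_graph G) \<longleftrightarrow> g \<noteq> h \<and> (g \<in> generate G {h} \<or> h \<in> generate G {g})"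
  using assms by (auto simp: power_graph_def generate_pow)

lemma sim4_iff:
  "sim4 G H \<longleftrightarrow> (\<exists>\<phi>. bij_betw \<phi> (carrier G) (carrier H) \<and>
     (\<forall>g\<in>carrier G. \<forall>h\<in>carrier G.
        (g, h) \<in> parcs (power_graph G) \<longleftrightarrow> (\<phi> g, \<phi> h) \<in> parcs (power_graph H)))"
  unfolding sim4_def pair_digraph_iso_iff[OF pair_wf_power_graph pair_wf_power_graph]
  by (simp add: power_graph_def)

lemma sim4_if_sim2:
  assumes G: "finite_group G" and H: "finite_group H" and "sim2 G H"
  shows "sim4 G H"
proof -
  interpret G: finite_group G by fact
  interpret H: finite_group H by fact
  obtain \<phi> where \<phi>: "bij_betw \<phi> (carrier G) (carrier H)"
    and hom: "\<forall>g\<in>carrier G. \<forall>t::nat. \<phi> (g [^]\<^bsub>G\<^esub> t) = \<phi> g [^]\<^bsub>H\<^esub> t"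
    using sim2_nat[OF \<open>sim2 G H\<close>] by blast
  have inj: "inj_on \<phi> (carrier G)" using \<phi> by (simp add: bij_betw_def)
  have \<phi>H: "\<phi> g \<in> carrier H" if "g \<in> carrier G" for g
    using \<phi> that by (auto simp: bij_betw_def)
  have "\<phi> g \<in> generate H {\<phi> h} \<longleftrightarrow> g \<in> generate G {h}" if "g \<in> carrier G" "h \<in> carrier G" for g h
    using power_map_image_cyc[OF G H \<phi> hom that(2), symmetric] that(1)
      inj_on_image_mem_iff[OF inj _ G.cyc_subset_carrier[OF that(2)]] by simp
  then show ?thesis
    unfolding sim4_iff using \<phi> \<phi>H inj_on_eq_iff[OF inj]
    by (intro exI[of _ \<phi>]) (auto simp: G.power_graph_arc_iff H.power_graph_arc_iff)
qed

lemma (in finite_group) nbhd_iff_arc: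
  assumes "x \<in> carrier G" "y \<in> carrier G"
  shows "y \<in> nbhd x \<longleftrightarrow> x = y \<or> (x, y) \<in> parcs (power_graph G)"
  using assms cyc_self by (auto simp: nbhd_def power_graph_arc_iff)

lemma sim2_if_sim4:
  assumes G: "finite_group G" and H: "finite_group H" and "sim4 G H"
  shows "sim2 G H"
proof -
  interpret G: finite_group G by fact
  interpret H: finite_group H by fact
  obtain \<phi> where \<phi>: "bij_betw \<phi> (carrier G) (carrier H)"
    and arcs: "\<forall>g\<in>carrier G. \<forall>h\<in>carrier G.
      (g, h) \<in> parcs (power_graph G) \<longleftrightarrow> (\<phi> g, \<phi> h) \<in> parcs (power_graph H)"
    using \<open>sim4 G H\<close> unfolding sim4_iff by metis
  have "power_graph_iso G H \<phi>"
  proof unfold_locales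
    fix x y assume xy: "x \<in> carrier G" "y \<in> carrier G"
    then have "\<phi> x \<in> carrier H" "\<phi> y \<in> carrier H" using \<phi> by (auto simp: bij_betw_def)
    moreover have "\<phi> x = \<phi> y \<longleftrightarrow> x = y"
      using inj_on_eq_iff[OF bij_betw_imp_inj_on[OF \<phi>] xy] .
    ultimately show "\<phi> y \<in> H.nbhd (\<phi> x) \<longleftrightarrow> y \<in> G.nbhd x"
      using arcs[rule_format, OF xy] xy by (simp add: G.nbhd_iff_arc H.nbhd_iff_arc)
  qed (rule \<phi>)
  then show ?thesis by (rule power_graph_iso.sim2_of_power_graph_iso)
qed

section \<open>Direct products\<close>

lemma finite_group_DirProd:
  assumes "finite_group G" "finite_group H"
  shows "finite_group (G \<times>\<times> H)"
  using assms by (simp add: finite_group_def finite_group_axioms_def DirProd_group)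

lemma nat_pow_DirProd: "(g, h) [^]\<^bsub>G \<times>\<times> H\<^esub> (t::nat) = (g [^]\<^bsub>G\<^esub> t, h [^]\<^bsub>H\<^esub> t)"
  by (induction t) (simp_all add: nat_pow_def)

lemma int_pow_DirProd:
  assumes "group G" "group H" "g \<in> carrier G" "h \<in> carrier H"
  shows "(g, h) [^]\<^bsub>G \<times>\<times> H\<^esub> (t::int) = (g [^]\<^bsub>G\<^esub> t, h [^]\<^bsub>H\<^esub> t)"
proof -
  interpret G: group G by fact
  interpret H: group H by fact
  interpret GH: group "G \<times>\<times> H" using assms by (intro DirProd_group)
  show ?thesis
  proof (cases t rule: int_cases2)
    case (nonneg n)
    then show ?thesis by (simp add: int_pow_int nat_pow_DirProd)
  next
    case (nonpos n)
    then show ?thesis using assms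
      by (simp add: G.int_pow_neg H.int_pow_neg GH.int_pow_neg int_pow_int nat_pow_DirProd)
  qed
qed

lemma bij_betw_DirProd:
  assumes "bij_betw \<phi> (carrier G1) (carrier H1)" "bij_betw \<psi> (carrier G2) (carrier H2)"
  shows "bij_betw (map_prod \<phi> \<psi>) (carrier (G1 \<times>\<times> G2)) (carrier (H1 \<times>\<times> H2))"
  using bij_betw_map_prod[OF assms] by simp

lemma sim2_DirProd:
  assumes "group G1" "group G2" "group H1" "group H2" "sim2 G1 H1" "sim2 G2 H2"
  shows "sim2 (G1 \<times>\<times> G2) (H1 \<times>\<times> H2)"
proof -
  obtain \<phi> where \<phi>: "bij_betw \<phi> (carrier G1) (carrier H1)"
    "\<forall>g\<in>carrier G1. \<forall>t::int. \<phi> (g [^]\<^bsub>G1\<^esub> t) = \<phi> g [^]\<^bsub>H1\<^esub> t"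
    using assms unfolding sim2_def by blast
  obtain \<psi> where \<psi>: "bij_betw \<psi> (carrier G2) (carrier H2)"
    "\<forall>g\<in>carrier G2. \<forall>t::int. \<psi> (g [^]\<^bsub>G2\<^esub> t) = \<psi> g [^]\<^bsub>H2\<^esub> t"
    using assms unfolding sim2_def by blast
  have "\<phi> g \<in> carrier H1" "\<psi> h \<in> carrier H2" if "g \<in> carrier G1" "h \<in> carrier G2" for g h
    using \<phi>(1) \<psi>(1) that by (auto simp: bij_betw_def)
  then show ?thesis
    unfolding sim2_def using bij_betw_DirProd[OF \<phi>(1) \<psi>(1)] \<phi>(2) \<psi>(2) assms
    by (intro exI[of _ "map_prod \<phi> \<psi>"]) (auto simp: int_pow_DirProd)
qed

lemma sim5_iff:
  assumes "group G" "group H"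
  shows "sim5 G H \<longleftrightarrow> (\<forall>t::int. \<exists>\<phi>. bij_betw \<phi> (carrier G) (carrier H) \<and>
    (\<forall>g\<in>carrier G. \<phi> (g [^]\<^bsub>G\<^esub> t) = \<phi> g [^]\<^bsub>H\<^esub> t))"
proof -
  have "(\<forall>x\<in>carrier G. \<forall>y\<in>carrier G. (y = x [^]\<^bsub>G\<^esub> t) = (\<phi> y = \<phi> x [^]\<^bsub>H\<^esub> t)) \<longleftrightarrow>
      (\<forall>g\<in>carrier G. \<phi> (g [^]\<^bsub>G\<^esub> t) = \<phi> g [^]\<^bsub>H\<^esub> t)"
    if "bij_betw \<phi> (carrier G) (carrier H)" for t :: int and \<phi>
    using that group.int_pow_closed[OF assms(1)] unfolding bij_betw_def by (metis inj_onD)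
  moreover have "(x, y) \<in> parcs (power_map_digraph t G) \<longleftrightarrow> y = x [^]\<^bsub>G\<^esub> t" if "x \<in> carrier G" for x y t
    using that by (auto simp: power_map_digraph_def)
  moreover have "(\<phi> x, \<phi> y) \<in> parcs (power_map_digraph t H) \<longleftrightarrow> \<phi> y = \<phi> x [^]\<^bsub>H\<^esub> t"
    if "x \<in> carrier G" "bij_betw \<phi> (carrier G) (carrier H)" for x y t \<phi>
    using that by (auto simp: power_map_digraph_def bij_betw_def)
  ultimately show ?thesis
    unfolding sim5_def pair_digraph_iso_iff[OF pair_wf_power_map_digraph[OF assms(1)] pair_wf_power_map_digraph[OF assms(2)]]
    by (simp add: power_map_digraph_def cong: conj_cong)
qed

lemma sim5_DirProd:
  assumes "group G1" "group G2" "group H1" "group H2" "sim5 G1 H1" "sim5 G2 H2"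
  shows "sim5 (G1 \<times>\<times> G2) (H1 \<times>\<times> H2)"
  unfolding sim5_iff[OF DirProd_group[OF assms(1,2)] DirProd_group[OF assms(3,4)]]
proof
  fix t :: int
  obtain \<phi> where \<phi>: "bij_betw \<phi> (carrier G1) (carrier H1)"
    "\<forall>g\<in>carrier G1. \<phi> (g [^]\<^bsub>G1\<^esub> t) = \<phi> g [^]\<^bsub>H1\<^esub> t"
    using assms sim5_iff[of G1 H1] by blast
  obtain \<psi> where \<psi>: "bij_betw \<psi> (carrier G2) (carrier H2)"
    "\<forall>g\<in>carrier G2. \<psi> (g [^]\<^bsub>G2\<^esub> t) = \<psi> g [^]\<^bsub>H2\<^esub> t"
    using assms sim5_iff[of G2 H2] by blast
  have "\<phi> g \<in> carrier H1" "\<psi> h \<in> carrier H2" if "g \<in> carrier G1" "h \<in> carrier G2" for g h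
    using \<phi>(1) \<psi>(1) that by (auto simp: bij_betw_def)
  then show "\<exists>\<phi>. bij_betw \<phi> (carrier (G1 \<times>\<times> G2)) (carrier (H1 \<times>\<times> H2)) \<and>
    (\<forall>g\<in>carrier (G1 \<times>\<times> G2). \<phi> (g [^]\<^bsub>G1 \<times>\<times> G2\<^esub> t) = \<phi> g [^]\<^bsub>H1 \<times>\<times> H2\<^esub> t)"
    using bij_betw_DirProd[OF \<phi>(1) \<psi>(1)] \<phi>(2) \<psi>(2) assms
    by (intro exI[of _ "map_prod \<phi> \<psi>"]) (auto simp: int_pow_DirProd)
qed

lemma ord_DirProd:
  assumes "group G" "group H" "g \<in> carrier G" "h \<in> carrier H"
  shows "group.ord (G \<times>\<times> H) (g, h) = lcm (group.ord G g) (group.ord H h)"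
proof -
  interpret G: group G by fact
  interpret H: group H by fact
  interpret GH: group "G \<times>\<times> H" using assms by (intro DirProd_group)
  show ?thesis
    using assms by (subst GH.ord_unique) (auto simp: nat_pow_DirProd G.pow_eq_id H.pow_eq_id)
qed

lemma image_mset_mset_set_sum: "image_mset f (mset_set A) = (\<Sum>a\<in>A. {#f a#})"
  by (induction A rule: infinite_finite_induct) auto

lemma order_multiset_DirProd:
  assumes "finite_group G" "finite_group H"
  shows "order_multiset (G \<times>\<times> H) =
    (\<Sum>m\<in>#order_multiset G. image_mset (lcm m) (order_multiset H))"
proof -
  have G: "group G" "finite (carrier G)" and H: "group H" "finite (carrier H)"
    using assms by (auto simp: finite_group_def finite_group_axioms_def)
  have "order_multiset (G \<times>\<times> H) = (\<Sum>x\<in>carrier G \<times> carrier H. {#group.ord (G \<times>\<times> H) x#})"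
    unfolding order_multiset_def carrier_DirProd image_mset_mset_set_sum ..
  also have "\<dots> = (\<Sum>g\<in>carrier G. \<Sum>h\<in>carrier H. {#lcm (group.ord G g) (group.ord H h)#})"
    using G H by (auto simp: sum.cartesian_product ord_DirProd intro!: sum.cong)
  also have "\<dots> = (\<Sum>g\<in>carrier G. image_mset (lcm (group.ord G g)) (order_multiset H))"
    unfolding order_multiset_def image_mset.compositionality by (simp add: image_mset_mset_set_sum o_def)
  also have "\<dots> = (\<Sum>m\<in>#order_multiset G. image_mset (lcm m) (order_multiset H))"
    unfolding order_multiset_def[of G] by (simp add: image_mset.compositionality o_def sum_unfold_sum_mset)
  finally show ?thesis .
qed

lemma sim6_DirProd:
  assumes "finite_group G1" "finite_group G2" "finite_group H1" "finite_group H2" "sim6 G1 H1" "sim6 G2 H2"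
  shows "sim6 (G1 \<times>\<times> G2) (H1 \<times>\<times> H2)"
  using assms by (simp add: sim6_def order_multiset_DirProd)

lemma sim1_DirProd:
  assumes "group G1" "sim1 G1 H1" "sim1 G2 H2"
  shows "sim1 (G1 \<times>\<times> G2) (H1 \<times>\<times> H2)"
  using assms group.DirProd_iso_trans unfolding sim1_def by blast

theorem theorem2p9:
  fixes j :: nat
    and G1 :: "('a1, 'm1) monoid_scheme" and H1 :: "('b1, 'n1) monoid_scheme"
    and G2 :: "('a2, 'm2) monoid_scheme" and H2 :: "('b2, 'n2) monoid_scheme"
  assumes "1 \<le> j" and "j \<le> 6"
    and "group G1" and "finite (carrier G1)"
    and "group H1" and "finite (carrier H1)"
    and "group G2" and "finite (carrier G2)"
    and "group H2" and "finite (carrier H2)"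
    and "sim j G1 H1" and "sim j G2 H2"
  shows "sim j (G1 \<times>\<times> G2) (H1 \<times>\<times> H2)"
proof -
  have G1: "finite_group G1" and H1: "finite_group H1" and G2: "finite_group G2" and H2: "finite_group H2"
    using assms(3-10) by (simp_all add: finite_group_def finite_group_axioms_def)
  note GG = finite_group_DirProd[OF G1 G2] and HH = finite_group_DirProd[OF H1 H2]
  have prod2: "sim2 (G1 \<times>\<times> G2) (H1 \<times>\<times> H2)" if "sim2 G1 H1" "sim2 G2 H2"
    using sim2_DirProd assms(3,5,7,9) that by blast
  consider "j = 1" | "j = 2" | "j = 3" | "j = 4" | "j = 5" | "j = 6"
    using \<open>1 \<le> j\<close> \<open>j \<le> 6\<close> by linarith
  then show ?thesis
  proof cases
    case 1
    then show ?thesis using sim1_DirProd assms(3,11,12) by (simp add: sim_def)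
  next
    case 2
    then show ?thesis using prod2 assms(11,12)
      by (simp add: sim_def)
  next
    case 3
    then have "sim3 G1 H1" "sim3 G2 H2" using assms(11,12) by (simp_all add: sim_def)
    then have "sim3 (G1 \<times>\<times> G2) (H1 \<times>\<times> H2)"
      using sim3_if_sim2[OF GG HH] prod2 sim2_if_sim3[OF G1 H1] sim2_if_sim3[OF G2 H2] by blast
    then show ?thesis using \<open>j = 3\<close> by (simp add: sim_def)
  next
    case 4
    then have "sim4 G1 H1" "sim4 G2 H2" using assms(11,12) by (simp_all add: sim_def)
    then have "sim4 (G1 \<times>\<times> G2) (H1 \<times>\<times> H2)"
      using sim4_if_sim2[OF GG HH] prod2 sim2_if_sim4[OF G1 H1] sim2_if_sim4[OF G2 H2] by blast
    then show ?thesis using \<open>j = 4\<close> by (simp add: sim_def)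
  next
    case 5
    then have "sim5 G1 H1" "sim5 G2 H2" using assms(11,12) by (simp_all add: sim_def)
    then have "sim5 (G1 \<times>\<times> G2) (H1 \<times>\<times> H2)" using sim5_DirProd assms(3,5,7,9) by blast
    then show ?thesis using \<open>j = 5\<close> by (simp add: sim_def)
  next
    case 6
    then have "sim6 G1 H1" "sim6 G2 H2" using assms(11,12) by (simp_all add: sim_def)
    then have "sim6 (G1 \<times>\<times> G2) (H1 \<times>\<times> H2)" using sim6_DirProd[OF G1 G2 H1 H2] by blast
    then show ?thesis using \<open>j = 6\<close> by (simp add: sim_def)
  qed
qed

end
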